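(* Let $A$ be a $C^*$-algebra, and let $a\in A_+$. Then the following are equivalent: (1) The element $a$ is soft. (2) For every closed ideal $I\subseteq A$, either $a\in I$ or the spectrum of $a+I\in A/I$ has $0$ as a limit point. (3) We have $a\lhd g_\varepsilon(a)$ for every $\varepsilon>0$. (4) For every $\varepsilon>0$ there exists $b\in(\overline{aAa})_+$ with $b\perp(a-\varepsilon)_+$ and $a\lhd b$.
   Context: A $C^*$-algebra $B$ is called soft if for every proper closed (two-sided) ideal $I\subseteq B$ the quotient $B/I$ is nonunital (i.e. $B$ has no nonzero unital quotient). An element $x$ of a $C^*$-algebra $A$ is called soft (in $A$) if the hereditary sub-$C^*$-algebra $\overline{x^*Ax}$ is soft; for $a\in A_+$ this means that $\overline{aAa}$ is soft. $A_+$ denotes the positive elements of $A$, and ideals are two-sided. For $a,b\in A_+$: $a\perp b$ means $ab=0$, and $a\lhd b$ means that $a$ belongs to the closed ideal of $A$ generated by $b$. For $a\in A_+$ and $\varepsilon>0$, $(a-\varepsilon)_+$ is obtained by functional calculus with $t\mapsto\max(t-\varepsilon,0)$. For $\varepsilon>0$, $g_\varepsilon\colon\mathbb{R}\to\mathbb{R}$ is the continuous function with $g_\varepsilon(t)=0$ for $t\in(-\infty,0]\cup[\varepsilon,\infty)$, $g_\varepsilon(t)=t$ for $t\in[0,\tfrac{\varepsilon}{2}]$, and $g_\varepsilon(t)=\varepsilon-t$ for $t\in[\tfrac{\varepsilon}{2},\varepsilon]$. *)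

theory Defs
  imports "HOL-Analysis.Analysis"
begin

text \<open>
  \<open>C\<^sup>*\<close>-algebras over the complex numbers, not assumed to have a unit.  The zero algebra is
  allowed.
\<close>

class cstar_algebra = real_normed_algebra + complete_space +
  fixes scaleC :: "complex \<Rightarrow> 'a \<Rightarrow> 'a"  (infixr \<open>*\<^sub>C\<close> 75)
    and star :: "'a \<Rightarrow> 'a"
  assumes scaleC_add_right: "c *\<^sub>C (x + y) = c *\<^sub>C x + c *\<^sub>C y"
    and scaleC_add_left: "(c + d) *\<^sub>C x = c *\<^sub>C x + d *\<^sub>C x"
    and scaleC_scaleC: "c *\<^sub>C (d *\<^sub>C x) = (c * d) *\<^sub>C x"
    and scaleC_of_real: "complex_of_real r *\<^sub>C x = r *\<^sub>R x"
    and mult_scaleC_left: "(c *\<^sub>C x) * y = c *\<^sub>C (x * y)"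
    and mult_scaleC_right: "x * (c *\<^sub>C y) = c *\<^sub>C (x * y)"
    and norm_scaleC: "norm (c *\<^sub>C x) = cmod c * norm x"
    and star_star: "star (star x) = x"
    and star_add: "star (x + y) = star x + star y"
    and star_mult: "star (x * y) = star y * star x"
    and star_scaleC: "star (c *\<^sub>C x) = cnj c *\<^sub>C star x"
    and cstar_identity: "norm (star x * x) = (norm x)\<^sup>2"

text \<open>
  Units and spectra depend only on the underlying complex algebra.  Subalgebras, quotients and
  unitizations are therefore handled as records carrying just the algebraic operations.
\<close>

record 'b complex_alg =
  alg_carrier :: "'b set"
  alg_zero :: "'b"
  alg_add :: "'b \<Rightarrow> 'b \<Rightarrow> 'b"
  alg_mult :: "'b \<Rightarrow> 'b \<Rightarrow> 'b"
  alg_scale :: "complex \<Rightarrow> 'b \<Rightarrow> 'b"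

definition subalg :: "'a::cstar_algebra set \<Rightarrow> 'a complex_alg" where
  "subalg B = \<lparr>alg_carrier = B, alg_zero = 0, alg_add = (+), alg_mult = (*), alg_scale = scaleC\<rparr>"

definition alg_coset :: "'b complex_alg \<Rightarrow> 'b set \<Rightarrow> 'b \<Rightarrow> 'b set" where
  "alg_coset M I x = alg_add M x ` I"

definition quotient_alg :: "'b complex_alg \<Rightarrow> 'b set \<Rightarrow> 'b set complex_alg" where
  "quotient_alg M I =
    \<lparr>alg_carrier = alg_coset M I ` alg_carrier M,
     alg_zero = I,
     alg_add = (\<lambda>X Y. \<Union>x\<in>X. \<Union>y\<in>Y. alg_coset M I (alg_add M x y)),
     alg_mult = (\<lambda>X Y. \<Union>x\<in>X. \<Union>y\<in>Y. alg_coset M I (alg_mult M x y)),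
     alg_scale = (\<lambda>c X. \<Union>x\<in>X. alg_coset M I (alg_scale M c x))\<rparr>"

definition is_unit_of :: "'b complex_alg \<Rightarrow> 'b \<Rightarrow> bool" where
  "is_unit_of M e \<longleftrightarrow>
    e \<in> alg_carrier M \<and> (\<forall>x\<in>alg_carrier M. alg_mult M e x = x \<and> alg_mult M x e = x)"

definition unital :: "'b complex_alg \<Rightarrow> bool" where
  "unital M \<longleftrightarrow> (\<exists>e. is_unit_of M e)"

definition unit_of :: "'b complex_alg \<Rightarrow> 'b" where
  "unit_of M = (THE e. is_unit_of M e)"

definition unitization :: "'b complex_alg \<Rightarrow> ('b \<times> complex) complex_alg" where
  "unitization M =
    \<lparr>alg_carrier = alg_carrier M \<times> UNIV,
     alg_zero = (alg_zero M, 0),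
     alg_add = (\<lambda>(x, c) (y, d). (alg_add M x y, c + d)),
     alg_mult = (\<lambda>(x, c) (y, d).
       (alg_add M (alg_mult M x y) (alg_add M (alg_scale M c y) (alg_scale M d x)), c * d)),
     alg_scale = (\<lambda>k (x, c). (alg_scale M k x, k * c))\<rparr>"

definition alg_invertible :: "'b complex_alg \<Rightarrow> 'b \<Rightarrow> bool" where
  "alg_invertible M x \<longleftrightarrow>
    (\<exists>y\<in>alg_carrier M. alg_mult M x y = unit_of M \<and> alg_mult M y x = unit_of M)"

definition unital_spectrum :: "'b complex_alg \<Rightarrow> 'b \<Rightarrow> complex set" where
  "unital_spectrum M x = {z. \<not> alg_invertible M (alg_add M x (alg_scale M (- z) (unit_of M)))}"

text \<open>In a nonunital algebra the spectrum is the one computed in the unitization.\<close>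

definition spectrum :: "'b complex_alg \<Rightarrow> 'b \<Rightarrow> complex set" where
  "spectrum M x =
    (if unital M then unital_spectrum M x
     else unital_spectrum (unitization M) (x, 0))"

definition closed_ideal :: "'a::cstar_algebra set \<Rightarrow> 'a set \<Rightarrow> bool" where
  "closed_ideal B I \<longleftrightarrow>
    I \<subseteq> B \<and> closed I \<and> 0 \<in> I \<and>
    (\<forall>x\<in>I. \<forall>y\<in>I. x + y \<in> I) \<and> (\<forall>c. \<forall>x\<in>I. c *\<^sub>C x \<in> I) \<and>
    (\<forall>b\<in>B. \<forall>x\<in>I. b * x \<in> I \<and> x * b \<in> I)"

text \<open>Here \<open>B\<close> is meant to be a sub-\<open>C\<^sup>*\<close>-algebra of the ambient algebra.\<close>

definition soft_algebra :: "'a::cstar_algebra set \<Rightarrow> bool" where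
  "soft_algebra B \<longleftrightarrow>
    (\<forall>I. closed_ideal B I \<and> I \<noteq> B \<longrightarrow> \<not> unital (quotient_alg (subalg B) I))"

definition soft :: "'a::cstar_algebra \<Rightarrow> bool" where
  "soft x \<longleftrightarrow> soft_algebra (closure (range (\<lambda>y. star x * y * x)))"

definition positives :: "'a::cstar_algebra set \<Rightarrow> 'a set" where
  "positives B = {b \<in> B. star b = b \<and> spectrum (subalg B) b \<subseteq> complex_of_real ` {0..}}"

definition generated_ideal :: "'a::cstar_algebra \<Rightarrow> 'a set" where
  "generated_ideal b = \<Inter>{I. closed_ideal UNIV I \<and> b \<in> I}"

definition ideal_below :: "'a::cstar_algebra \<Rightarrow> 'a \<Rightarrow> bool"  (infix \<open>\<lhd>\<close> 50) where
  "a \<lhd> b \<longleftrightarrow> a \<in> generated_ideal b"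

definition orthogonal_elts :: "'a::cstar_algebra \<Rightarrow> 'a \<Rightarrow> bool"  (infix \<open>\<bottom>\<close> 50) where
  "a \<bottom> b \<longleftrightarrow> a * b = 0"

text \<open>
  Continuous functional calculus of a self-adjoint element \<open>a\<close>: the unique isometric
  \<open>*\<close>-homomorphism from the continuous complex-valued functions on the union of \<open>{0}\<close> and the
  spectrum of \<open>a\<close> that vanish at 0, sending the identity function to \<open>a\<close>.  Only the values of
  functions on that set matter, because the homomorphism is linear and isometric.
\<close>

definition spec0 :: "'a::cstar_algebra \<Rightarrow> real set" where
  "spec0 a = insert 0 {t. complex_of_real t \<in> spectrum (subalg UNIV) a}"

definition C0_spec :: "'a::cstar_algebra \<Rightarrow> (real \<Rightarrow> complex) set" where
  "C0_spec a = {f. continuous_on (spec0 a) f \<and> f 0 = 0}"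

definition is_functional_calculus ::
    "'a::cstar_algebra \<Rightarrow> ((real \<Rightarrow> complex) \<Rightarrow> 'a) \<Rightarrow> bool" where
  "is_functional_calculus a \<Phi> \<longleftrightarrow>
    (\<forall>f\<in>C0_spec a. \<forall>g\<in>C0_spec a.
       \<Phi> (\<lambda>t. f t + g t) = \<Phi> f + \<Phi> g \<and> \<Phi> (\<lambda>t. f t * g t) = \<Phi> f * \<Phi> g) \<and>
    (\<forall>f\<in>C0_spec a.
       (\<forall>c. \<Phi> (\<lambda>t. c * f t) = c *\<^sub>C \<Phi> f) \<and>
       \<Phi> (\<lambda>t. cnj (f t)) = star (\<Phi> f) \<and>
       norm (\<Phi> f) = (SUP t\<in>spec0 a. cmod (f t))) \<and>
    \<Phi> complex_of_real = a"

definition func_calc :: "(real \<Rightarrow> real) \<Rightarrow> 'a::cstar_algebra \<Rightarrow> 'a" where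
  "func_calc f a = (THE y. \<forall>\<Phi>. is_functional_calculus a \<Phi> \<longrightarrow> \<Phi> (\<lambda>t. complex_of_real (f t)) = y)"

definition cut_down :: "'a::cstar_algebra \<Rightarrow> real \<Rightarrow> 'a" where
  "cut_down a \<epsilon> = func_calc (\<lambda>t. max (t - \<epsilon>) 0) a"

definition tent :: "real \<Rightarrow> real \<Rightarrow> real" where
  "tent \<epsilon> t = (if t \<le> 0 \<or> \<epsilon> \<le> t then 0 else if t \<le> \<epsilon> / 2 then t else \<epsilon> - t)"

end

theory Submission
  imports Defs "HOL-Computational_Algebra.Fundamental_Theorem_Algebra"
begin

text \<open>
  For a closed ideal \<open>I\<close> with \<open>a \<notin> I\<close>, an isolated point 0 of the spectrum of \<open>a + I\<close> makes \<open>f(a)\<close>,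
  with \<open>f\<close> equal to 1 beyond the gap, a unit of \<open>B / (B \<inter> I)\<close> for \<open>B\<close> the closure of \<open>a A a\<close>; so (1) implies
  (2).  Modulo the ideal generated by \<open>g\<^sub>\<epsilon>(a)\<close> the element \<open>a\<close> has no spectrum in \<open>(0, \<epsilon>)\<close>, so (2)
  implies (3), and \<open>g\<^sub>\<epsilon>(a)\<close> itself is a witness for (4).  If (4) holds and \<open>B / J\<close> has a unit, then
  \<open>(a - \<epsilon>)\<^sub>+\<close> is invertible in \<open>B / J\<close> for small \<open>\<epsilon>\<close>, so a witness \<open>b\<close> lies in \<open>J\<close>; hence so does \<open>a\<close>,
  and \<open>J = B\<close>.

  Nonzero spectrum is expressed by quasi-inverses \<open>x + y = x y = y x\<close>, that is
  \<open>(1 - x) (1 - y) = 1\<close>, which need no unit; the value 0 never matters in the statement.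
\<close>

section \<open>Quasi-inverses and the spectral radius\<close>

text \<open>Two obstacles shape the proof. First, \<open>A/I\<close> enters only as an algebra of
  cosets, so no functional calculus is at hand in the quotient. All functions are applied to
  \<open>a\<close> inside the given algebra, and the distance \<open>infdist x I\<close> serves as
  quotient norm; that a gap in the spectrum of \<open>a + I\<close> puts suitable
  \<open>h(a)\<close> into \<open>I\<close> comes from a contraction estimate for this distance.
  Second, \<open>func_calc\<close> is a definite description over all functional calculi and says
  nothing until one is constructed and shown to be the only one. Its isometry rests on the spectral
  radius of self-adjoint elements, reached by uniform continuity and repeated squaring instead of
  complex function theory.

  The value 0 can be ignored because a limit point at 0 concerns only nonzero values, positivity
  admits 0, and \<open>spec0\<close> inserts it anyway.\<close>

lemma bounded_bilinear_scaleC: "bounded_bilinear (scaleC :: complex \<Rightarrow> 'a::cstar_algebra \<Rightarrow> 'a)"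
proof
  fix r :: real and c d :: complex and x y :: 'a
  show "(c + d) *\<^sub>C x = c *\<^sub>C x + d *\<^sub>C x" by (rule scaleC_add_left)
  show "c *\<^sub>C (x + y) = c *\<^sub>C x + c *\<^sub>C y" by (rule scaleC_add_right)
  show "(r *\<^sub>R c) *\<^sub>C x = r *\<^sub>R (c *\<^sub>C x)"
    by (metis scaleC_of_real scaleC_scaleC scaleR_conv_of_real)
  show "c *\<^sub>C (r *\<^sub>R x) = r *\<^sub>R (c *\<^sub>C x)"
    by (metis mult.commute scaleC_of_real scaleC_scaleC)
  show "\<exists>K. \<forall>c (x::'a). norm (c *\<^sub>C x) \<le> norm c * norm x * K"
    by (intro exI[of _ 1]) (simp add: norm_scaleC)
qed

interpretation scaleC: bounded_bilinear "scaleC :: complex \<Rightarrow> 'a::cstar_algebra \<Rightarrow> 'a"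
  by (rule bounded_bilinear_scaleC)

lemma scaleC_one [simp]: "1 *\<^sub>C x = (x::'a::cstar_algebra)"
  using scaleC_of_real[of 1 x] by simp

lemma scaleC_minus_one: "(-1) *\<^sub>C x = - (x::'a::cstar_algebra)"
  by (simp add: scaleC.minus_left)

lemmas scaleC_simps [simp] = scaleC.zero_left scaleC.zero_right scaleC_scaleC
  mult_scaleC_left mult_scaleC_right norm_scaleC star_star star_add star_mult star_scaleC

lemmas scaleC_algebra = scaleC.add_left scaleC.add_right scaleC.diff_left scaleC.diff_right
  scaleC.minus_left scaleC.minus_right

lemma norm_star [simp]: "norm (star x) = norm (x::'a::cstar_algebra)"
proof -
  have *: "norm x \<le> norm (star x)" for x :: 'a
  proof (cases "x = 0")
    case False
    have "norm x * norm x \<le> norm (star x) * norm x"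
      using norm_mult_ineq[of "star x" x] by (simp add: cstar_identity power2_eq_square)
    then show ?thesis using False by simp
  qed simp
  show ?thesis using *[of x] *[of "star x"] by simp
qed

section \<open>Quasi-inverses and their stability under perturbation\<close>

definition qinv :: "'a::ring \<Rightarrow> 'a \<Rightarrow> bool" where
  "qinv x y \<longleftrightarrow> x + y = x * y \<and> x + y = y * x"

lemma qinv_commute: "qinv x y \<longleftrightarrow> qinv y x"
  by (auto simp: qinv_def add.commute)

lemma left_right_quasi_inverse_eq:
  fixes x :: "'a::ring"
  assumes "x + y = x * y" "x + z = z * x"
  shows "y = z"
proof -
  have "z * (x + y) = z * (x * y)" by (simp add: assms)
  also have "\<dots> = (x + z) * y" by (simp add: assms mult.assoc)
  finally have "z * x = x * y" by (simp add: algebra_simps)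
  then show ?thesis using assms by (metis add_left_cancel)
qed

lemma qinv_unique: "qinv x y \<Longrightarrow> qinv x z \<Longrightarrow> y = z"
  by (meson left_right_quasi_inverse_eq qinv_def)

text \<open>Jacobson's circle operation: \<open>(1 - x) (1 - y) = 1 - circ x y\<close>. It
  transports multiplication of elements \<open>1 - x\<close> to an algebra without unit, whence
  associativity and the neutral element 0.\<close>

definition circ :: "'a::ring \<Rightarrow> 'a \<Rightarrow> 'a" where
  "circ x y = x + y - x * y"

lemma circ_assoc: "circ (circ x y) z = circ x (circ y z)"
  by (simp add: circ_def algebra_simps)

lemma circ_zero [simp]: "circ 0 x = x" "circ x 0 = x"
  by (simp_all add: circ_def)

lemma qinv_iff_circ: "qinv x y \<longleftrightarrow> circ x y = 0 \<and> circ y x = 0"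
  by (auto simp: qinv_def circ_def add.commute)

lemma qinv_circ: "qinv x y \<Longrightarrow> qinv w v \<Longrightarrow> qinv (circ x w) (circ v y)"
  unfolding qinv_iff_circ by (metis circ_assoc circ_zero)

text \<open>Partial fractions: \<open>1 / (1 - x^2)\<close> is the mean of
  \<open>1 / (1 - x)\<close> and \<open>1 / (1 + x)\<close>, and these inverses are
  \<open>1 - y\<close> and \<open>1 - v\<close>.\<close>

lemma qinv_square:
  fixes x :: "'a::cstar_algebra"
  assumes "qinv x y" "qinv (- x) v"
  shows "qinv (x * x) ((1/2) *\<^sub>R (y + v))"
proof -
  have a: "x * y = x + y" "y * x = x + y" "x * v = x - v" "v * x = x - v"
    using assms by (auto simp: qinv_def algebra_simps eq_neg_iff_add_eq_0)
  have b: "x * (x * y) = x * x + x + y" "(y * x) * x = x * x + x + y"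
    by (simp_all add: a algebra_simps)
  have c: "x * (x * v) = x * x - x + v" "(v * x) * x = x * x - x + v"
    by (simp_all add: a algebra_simps)
  have d: "x * x * (y + v) = 2 *\<^sub>R (x * x) + (y + v)" "(y + v) * (x * x) = 2 *\<^sub>R (x * x) + (y + v)"
    using b c by (simp_all add: algebra_simps scaleR_2)
  have "x * x + (1/2) *\<^sub>R (y + v) = (1/2) *\<^sub>R (2 *\<^sub>R (x * x) + (y + v))"
    by (simp add: scaleR_right_distrib)
  then show ?thesis unfolding qinv_def using d
    by (simp only: mult_scaleR_left mult_scaleR_right)
qed

text \<open>In place of a Neumann series: the solution is the fixed point of
  \<open>y |-> x * y - x\<close>, a contraction with constant \<open>norm x\<close>.\<close>

lemma left_quasi_inverse_exists:
  fixes x :: "'a::{real_normed_algebra,complete_space}"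
  assumes "norm x < 1"
  shows "\<exists>y. x + y = x * y"
proof -
  have "\<exists>!y\<in>UNIV. x * y - x = y"
  proof (rule Banach_fix[where c = "norm x"])
    show "complete (UNIV::'a set)" by (simp add: complete_UNIV)
    show "dist (x * u - x) (x * v - x) \<le> norm x * dist u v" for u v
      using norm_mult_ineq[of x "u - v"] by (simp add: dist_norm right_diff_distrib)
  qed (use assms in auto)
  then obtain y where "x * y - x = y" by blast
  then show ?thesis by (intro exI[of _ y]) (simp add: algebra_simps)
qed

lemma right_quasi_inverse_exists:
  fixes x :: "'a::{real_normed_algebra,complete_space}"
  assumes "norm x < 1"
  shows "\<exists>y. x + y = y * x"
proof -
  have "\<exists>!y\<in>UNIV. y * x - x = y"
  proof (rule Banach_fix[where c = "norm x"])
    show "complete (UNIV::'a set)" by (simp add: complete_UNIV)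
    show "dist (u * x - x) (v * x - x) \<le> norm x * dist u v" for u v
      using norm_mult_ineq[of "u - v" x] by (simp add: dist_norm left_diff_distrib mult.commute)
  qed (use assms in auto)
  then obtain y where "y * x - x = y" by blast
  then show ?thesis by (intro exI[of _ y]) (simp add: algebra_simps)
qed

lemma qinv_small_exists:
  fixes x :: "'a::{real_normed_algebra,complete_space}"
  assumes "norm x < 1"
  shows "\<exists>y. qinv x y"
  by (metis assms left_quasi_inverse_exists left_right_quasi_inverse_eq qinv_def
      right_quasi_inverse_exists)

text \<open>Kept free of division so that it also says something when \<open>norm x\<close> is not
  below 1; the spectral radius argument applies it with \<open>x\<close> and \<open>y\<close>
  exchanged to bound a quasi-inverse from below.\<close>

lemma qinv_norm_le:
  fixes x :: "'a::real_normed_algebra"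
  assumes "qinv x y"
  shows "(1 - norm x) * norm y \<le> norm x"
proof -
  have "y = x * y - x" using assms by (metis add_diff_cancel_left' qinv_def)
  then have "norm y \<le> norm (x * y) + norm x" by (metis norm_triangle_ineq4)
  also have "norm (x * y) \<le> norm x * norm y" by (rule norm_mult_ineq)
  finally show ?thesis by (simp add: algebra_simps)
qed

text \<open>Factor \<open>1 - x' = (1 - x) (1 - w)\<close> with \<open>w = (1 - y) (x' - x)\<close>.
  For \<open>x'\<close> near \<open>x\<close> the element \<open>w\<close> is small and has a small
  quasi-inverse \<open>v\<close>, so \<open>1 - x'\<close> has the inverse
  \<open>(1 - v) (1 - y)\<close>.\<close>

lemma qinv_perturb:
  fixes x :: "'a::{real_normed_algebra,complete_space}"
  assumes xy: "qinv x y" and e: "0 < e"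
  shows "\<exists>d>0. \<forall>x'. dist x' x < d \<longrightarrow> (\<exists>y'. qinv x' y' \<and> dist y' y < e)"
proof -
  define K where "K = 1 + norm y"
  have K: "K \<ge> 1" by (simp add: K_def)
  \<comment> \<open>\<open>r\<close> bounds \<open>norm w\<close>: the part 1/2 gives
    \<open>norm v < 2 * r\<close>, and \<open>e / (4 * K)\<close> then gives
    \<open>norm v * K <= e / 2\<close>.\<close>
  define r where "r = min (1/2) (e / (4 * K))"
  have r: "0 < r" "r \<le> 1/2" "r * K \<le> e / 4"
    using e K by (auto simp: r_def min_def field_simps)
  show ?thesis
  proof (intro exI[of _ "r / K"] conjI allI impI)
    show "r / K > 0" using r K by simp
  next
    fix x' assume d: "dist x' x < r / K"
    define w where "w = (x' - x) - y * (x' - x)"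
    have "norm w \<le> norm (x' - x) + norm y * norm (x' - x)"
      unfolding w_def by (meson add_left_mono norm_mult_ineq norm_triangle_ineq4 order_trans)
    also have "\<dots> = K * norm (x' - x)" by (simp add: K_def algebra_simps)
    also have "\<dots> < r" using d K by (simp add: dist_norm field_simps)
    finally have w: "norm w < r" .
    then obtain v where v: "qinv w v" using qinv_small_exists[of w] r by auto
    have "(1/2) * norm v \<le> (1 - norm w) * norm v" using w r by (intro mult_right_mono) auto
    also have "\<dots> \<le> norm w" by (rule qinv_norm_le[OF v])
    finally have nv: "norm v < 2 * r" using w by simp
    have "x * y = x + y" using xy by (simp add: qinv_def)
    then have "x * (y * u) = x * u + y * u" for u
      by (metis distrib_right mult.assoc)
    then have x': "x + w - x * w = x'" by (simp add: w_def algebra_simps)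
    have q: "qinv x' (v + y - v * y)" using qinv_circ[OF xy v] x' by (simp add: circ_def)
    have "norm (v - v * y) \<le> norm v + norm v * norm y"
      by (meson add_left_mono norm_mult_ineq norm_triangle_ineq4 order_trans)
    also have "\<dots> = norm v * K" by (simp add: K_def algebra_simps)
    also have "\<dots> \<le> 2 * r * K" using nv K by (intro mult_right_mono) auto
    also have "\<dots> < e" using r(3) e by simp
    finally have "dist (v + y - v * y) y < e" by (simp add: dist_norm algebra_simps)
    with q show "\<exists>y'. qinv x' y' \<and> dist y' y < e" by blast
  qed
qed

definition quasi_inverse :: "'a::ring \<Rightarrow> 'a" where
  "quasi_inverse x = (THE y. qinv x y)"

lemma quasi_inverse_eq: "qinv x y \<Longrightarrow> quasi_inverse x = y"
  unfolding quasi_inverse_def using qinv_unique by blast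

lemma continuous_on_quasi_inverse:
  "continuous_on {x :: 'a::{real_normed_algebra,complete_space}. \<exists>y. qinv x y} quasi_inverse"
  unfolding continuous_on_iff
proof (intro ballI allI impI)
  fix x :: 'a and e :: real assume "x \<in> {x. \<exists>y. qinv x y}" and e: "0 < e"
  then obtain y where y: "qinv x y" by auto
  show "\<exists>d>0. \<forall>x'\<in>{x. \<exists>y. qinv x y}. dist x' x < d \<longrightarrow> dist (quasi_inverse x') (quasi_inverse x) < e"
    using qinv_perturb[OF y e] quasi_inverse_eq[OF y] quasi_inverse_eq by metis
qed

section \<open>The spectral radius of self-adjoint elements by repeated squaring\<close>

definition iter_square :: "nat \<Rightarrow> 'a::times \<Rightarrow> 'a" where
  "iter_square n = ((\<lambda>x. x * x) ^^ n)"

lemma iter_square_simps [simp]: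
  "iter_square 0 x = x" "iter_square (Suc n) x = iter_square n x * iter_square n x"
  by (simp_all add: iter_square_def)

lemma iter_square_scaleC:
  "iter_square n (z *\<^sub>C x) = z ^ (2 ^ n) *\<^sub>C iter_square n (x::'a::cstar_algebra)"
  by (induction n) (simp_all add: power_add[symmetric] mult_2)

lemma star_iter_square:
  "star (c::'a::cstar_algebra) = c \<Longrightarrow> star (iter_square n c) = iter_square n c"
  by (induction n) simp_all

text \<open>Squares of a self-adjoint element are self-adjoint, so the C*-identity gives equality at
  every stage. This and \<open>qinv_square\<close> are why only exponents \<open>2 ^ n\<close>
  occur.\<close>

lemma norm_iter_square:
  assumes "star (c::'a::cstar_algebra) = c"
  shows "norm (iter_square n c) = norm c ^ (2 ^ n)"
proof (induction n)
  case (Suc n)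
  have "norm (iter_square n c * iter_square n c) = (norm (iter_square n c))\<^sup>2"
    by (metis cstar_identity star_iter_square[OF assms])
  then show ?case by (simp add: Suc power_mult[symmetric] mult.commute)
qed simp

lemma norm_iter_square_le:
  "norm (iter_square n (x::'a::real_normed_algebra)) \<le> norm x ^ (2 ^ n)"
proof (induction n)
  case (Suc n)
  have "norm (iter_square n x * iter_square n x) \<le> norm (iter_square n x) * norm (iter_square n x)"
    by (rule norm_mult_ineq)
  also have "\<dots> \<le> norm x ^ (2 ^ n) * norm x ^ (2 ^ n)" by (intro mult_mono Suc) auto
  finally show ?case by (simp add: power_add[symmetric] mult_2)
qed simp

text \<open>Rotating \<open>z\<close> by such a root with \<open>m = 2 ^ n\<close> changes the sign
  of \<open>iter_square n (z *\<^sub>C c)\<close> and keeps \<open>z\<close> on its circle. This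
  supplies the element \<open>- x\<close> needed in \<open>qinv_square\<close>.\<close>

lemma ex_root_minus_one:
  assumes "m > 0"
  shows "\<exists>z::complex. cmod z = 1 \<and> z ^ m = -1"
proof (intro exI conjI)
  show "cis (pi / m) ^ m = -1" using assms by (subst Complex.DeMoivre) simp
qed simp

text \<open>
  Otherwise the quasi-inverse of \<open>z c\<close> is uniformly continuous on the disc
  \<open>|z| \<le> 1 / \<parallel>c\<parallel>\<close>.  Since the quasi-inverse of \<open>x\<^sup>2\<close> is the mean of those of \<open>x\<close> and \<open>-x\<close>, the
  same modulus of continuity is inherited by the quasi-inverse of \<open>(z c)^(2^n)\<close> for all \<open>n\<close>.  But
  this power has norm 1 on the boundary circle and tends to 0 on every smaller one.
\<close>

lemma selfadjoint_spectral_radius: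
  fixes c :: "'a::cstar_algebra"
  assumes sa: "star c = c" and c0: "c \<noteq> 0"
  shows "\<exists>z. cmod z = 1 / norm c \<and> \<not> (\<exists>y. qinv (z *\<^sub>C c) y)"
proof (rule ccontr)
  assume "\<not> ?thesis"
  then have circ: "\<exists>y. qinv (z *\<^sub>C c) y" if "cmod z = 1 / norm c" for z using that by blast
  define M where "M = norm c"
  have M: "M > 0" using c0 by (simp add: M_def)
  have disc: "\<exists>y. qinv (z *\<^sub>C c) y" if "cmod z \<le> 1 / M" for z
  proof (cases "cmod z = 1 / M")
    case False
    then have "cmod z * M < 1" using that M by (simp add: field_simps)
    then show ?thesis by (intro qinv_small_exists) (simp add: M_def)
  qed (use circ M_def in auto)
  let ?G = "\<lambda>z. quasi_inverse (z *\<^sub>C c)"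
  have "continuous_on (cball 0 (1 / M)) ?G"
  proof (rule continuous_on_compose2[OF continuous_on_quasi_inverse])
    show "continuous_on (cball 0 (1 / M)) (\<lambda>z. z *\<^sub>C c)"
      by (intro scaleC.continuous_on continuous_intros)
  qed (use disc in auto)
  then have "uniformly_continuous_on (cball 0 (1 / M)) ?G"
    by (simp add: compact_uniformly_continuous)
  then obtain d where d: "d > 0" and
    uc: "\<forall>z\<in>cball 0 (1 / M). \<forall>z'\<in>cball 0 (1 / M). dist z' z < d \<longrightarrow> dist (?G z') (?G z) < 1/4"
    unfolding uniformly_continuous_on_def by (elim allE[of _ "1/4"]) auto
  \<comment> \<open>The circles of radii \<open>1 / M\<close> and \<open>s / M\<close> have to be
    closer than \<open>d\<close>; here \<open>(1 - s) / M <= d / 2\<close>, and the lower bound 1/2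
    keeps \<open>s\<close> positive.\<close>
  define s where "s = max (1/2) (1 - d * M / 2)"
  have s: "0 < s" "s < 1" "(1 - s) / M < d"
    using d M by (auto simp: s_def max_def field_simps)
  define Z where "Z = {z. cmod z = 1 / M}"
  \<comment> \<open>Claimed for the whole circle at once, since the step to \<open>Suc n\<close>
    uses the hypothesis at \<open>z\<close> and at its rotation \<open>\<zeta> * z\<close>.\<close>
  have main: "\<exists>y y'. qinv (iter_square n (z *\<^sub>C c)) y \<and>
      qinv (iter_square n ((of_real s * z) *\<^sub>C c)) y' \<and> dist y y' \<le> 1/4" if "z \<in> Z" for n z
    using that
  proof (induction n arbitrary: z)
    case 0
    then have z: "cmod z = 1 / M" by (simp add: Z_def)
    have sz: "cmod (of_real s * z) \<le> 1 / M" using s z M by (simp add: norm_mult mult_left_le_one_le divide_right_mono)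
    have "z - of_real s * z = of_real (1 - s) * z" by (simp add: algebra_simps)
    then have "dist z (of_real s * z) = (1 - s) * (1 / M)"
      using s z by (simp add: dist_norm norm_mult del: of_real_diff)
    then have "dist z (of_real s * z) < d" using s by simp
    then have "dist (?G z) (?G (of_real s * z)) < 1/4"
      using uc[rule_format, of "of_real s * z" z] sz z by simp
    moreover obtain y y' where "qinv (z *\<^sub>C c) y" "qinv ((of_real s * z) *\<^sub>C c) y'"
      using disc sz z by (metis order_refl)
    ultimately show ?case using quasi_inverse_eq by (metis iter_square_simps(1) less_imp_le)
  next
    case (Suc n)
    obtain \<zeta> :: complex where \<zeta>: "cmod \<zeta> = 1" "\<zeta> ^ (2 ^ n) = -1"
      using ex_root_minus_one[of "2 ^ n"] by auto
    have "\<zeta> * z \<in> Z" using Suc.prems \<zeta> by (simp add: Z_def norm_mult)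
    then obtain v v' where v: "qinv (iter_square n ((\<zeta> * z) *\<^sub>C c)) v"
      "qinv (iter_square n ((of_real s * (\<zeta> * z)) *\<^sub>C c)) v'" "dist v v' \<le> 1/4"
      using Suc.IH by metis
    obtain y y' where y: "qinv (iter_square n (z *\<^sub>C c)) y"
      "qinv (iter_square n ((of_real s * z) *\<^sub>C c)) y'" "dist y y' \<le> 1/4"
      using Suc by metis
    have neg: "iter_square n ((\<zeta> * w) *\<^sub>C c) = - iter_square n (w *\<^sub>C c)" for w
      by (simp add: iter_square_scaleC power_mult_distrib \<zeta> scaleC.minus_left)
    have 1: "qinv (iter_square (Suc n) (z *\<^sub>C c)) ((1/2) *\<^sub>R (y + v))"
      using qinv_square[OF y(1)] v(1) neg by simp
    have "of_real s * (\<zeta> * z) = \<zeta> * (of_real s * z)" by simp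
    then have 2: "qinv (iter_square (Suc n) ((of_real s * z) *\<^sub>C c)) ((1/2) *\<^sub>R (y' + v'))"
      using qinv_square[OF y(2)] v(2) neg by (metis iter_square_simps(2))
    have "dist ((1/2) *\<^sub>R (y + v)) ((1/2) *\<^sub>R (y' + v')) = (1/2) * dist (y + v) (y' + v')"
      by (simp add: dist_norm scaleR_right_diff_distrib[symmetric])
    also have "\<dots> \<le> 1/4"
      using dist_triangle_add[of y v y' v'] y(3) v(3) by simp
    finally show ?case using 1 2 by blast
  qed
  \<comment> \<open>The constants: a norm below 1/8 forces \<open>norm y' < 1/4\<close>, so distance
    at most 1/4 gives \<open>norm y < 1/2\<close>. But \<open>y\<close> is a quasi-inverse of an
    element of norm 1, and \<open>qinv_norm_le\<close> with the roles exchanged gives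
    \<open>norm y >= 1/2\<close>.\<close>
  obtain n where n: "s ^ (2 ^ n) < 1/8"
  proof -
    obtain m where "s ^ m < 1/8" using real_arch_pow_inv[of "1/8" s] s by auto
    moreover have "s ^ (2 ^ m) \<le> s ^ m"
      using s by (intro power_decreasing) (auto simp: less_imp_le)
    ultimately show ?thesis using that by (metis order_le_less_trans)
  qed
  define z where "z = complex_of_real (1 / M)"
  have z: "z \<in> Z" using M by (simp add: Z_def z_def norm_divide)
  obtain y y' where y: "qinv (iter_square n (z *\<^sub>C c)) y"
    "qinv (iter_square n ((of_real s * z) *\<^sub>C c)) y'" "dist y y' \<le> 1/4"
    using main[OF z] by blast
  have nz: "cmod z = 1 / M" using z by (simp add: Z_def)
  have "norm (iter_square n (z *\<^sub>C c)) = cmod z ^ (2 ^ n) * norm c ^ (2 ^ n)"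
    by (simp add: iter_square_scaleC norm_iter_square[OF sa] norm_power)
  also have "\<dots> = (1 / M * M) ^ (2 ^ n)" by (simp only: nz M_def power_mult_distrib)
  finally have n1: "norm (iter_square n (z *\<^sub>C c)) = 1" using M by simp
  have "norm (iter_square n ((of_real s * z) *\<^sub>C c)) \<le> norm ((of_real s * z) *\<^sub>C c) ^ (2 ^ n)"
    by (rule norm_iter_square_le)
  also have "norm ((of_real s * z) *\<^sub>C c) = s"
    using s M by (simp add: norm_mult nz flip: M_def)
  finally have n2: "norm (iter_square n ((of_real s * z) *\<^sub>C c)) < 1/8" using n by simp
  have "(7/8) * norm y' \<le> (1 - norm (iter_square n ((of_real s * z) *\<^sub>C c))) * norm y'"
    using n2 by (intro mult_right_mono) auto
  then have "norm y' < 1/4" using qinv_norm_le[OF y(2)] n2 by simp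
  moreover have "norm y \<le> norm y' + dist y y'" by (metis dist_norm norm_triangle_sub)
  moreover have "(1 - norm y) * 1 \<le> norm y"
    using qinv_norm_le[of y "iter_square n (z *\<^sub>C c)"] y(1) n1 by (simp add: qinv_commute)
  ultimately show False using y(3) by simp
qed

section \<open>Spectra in subalgebras and quotients\<close>

lemma unit_of_eq: "is_unit_of M e \<Longrightarrow> unit_of M = e"
  unfolding unit_of_def by (rule the_equality) (auto simp: is_unit_of_def)

text \<open>
  \<open>M\<close> is the algebra \<open>B / I\<close>, presented through the quotient map; this covers subalgebras
  (\<open>I = {0}\<close>) as well, and reduces computations in \<open>M\<close> to congruences in the type \<open>'a\<close>.
\<close>

locale alg_quotient =
  fixes M :: "'b complex_alg" and \<pi> :: "'a::cstar_algebra \<Rightarrow> 'b" and B I :: "'a set"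
  assumes carrier: "alg_carrier M = \<pi> ` B"
    and zero: "alg_zero M = \<pi> 0"
    and add: "x \<in> B \<Longrightarrow> y \<in> B \<Longrightarrow> alg_add M (\<pi> x) (\<pi> y) = \<pi> (x + y)"
    and mult: "x \<in> B \<Longrightarrow> y \<in> B \<Longrightarrow> alg_mult M (\<pi> x) (\<pi> y) = \<pi> (x * y)"
    and scale: "x \<in> B \<Longrightarrow> alg_scale M c (\<pi> x) = \<pi> (c *\<^sub>C x)"
    and eq_iff: "x \<in> B \<Longrightarrow> y \<in> B \<Longrightarrow> \<pi> x = \<pi> y \<longleftrightarrow> x - y \<in> I"
    and B_zero: "0 \<in> B"
    and B_add: "x \<in> B \<Longrightarrow> y \<in> B \<Longrightarrow> x + y \<in> B"
    and B_mult: "x \<in> B \<Longrightarrow> y \<in> B \<Longrightarrow> x * y \<in> B"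
    and B_scaleC: "x \<in> B \<Longrightarrow> c *\<^sub>C x \<in> B"
    and I_zero: "0 \<in> I"
    and I_add: "x \<in> I \<Longrightarrow> y \<in> I \<Longrightarrow> x + y \<in> I"
    and I_scaleC: "x \<in> I \<Longrightarrow> c *\<^sub>C x \<in> I"
begin

lemma B_minus: "x \<in> B \<Longrightarrow> - x \<in> B"
  using B_scaleC[of x "-1"] by (simp add: scaleC_minus_one)

lemma I_minus: "x \<in> I \<Longrightarrow> - x \<in> I"
  using I_scaleC[of x "-1"] by (simp add: scaleC_minus_one)

lemma B_diff: "x \<in> B \<Longrightarrow> y \<in> B \<Longrightarrow> x - y \<in> B"
  using B_add[OF _ B_minus] by fastforce

lemma I_diff: "x \<in> I \<Longrightarrow> y \<in> I \<Longrightarrow> x - y \<in> I"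
  using I_add[OF _ I_minus] by fastforce

lemmas B_closed = B_zero B_add B_mult B_scaleC B_minus B_diff

lemma is_unit_of_iff:
  assumes "e \<in> B"
  shows "is_unit_of M (\<pi> e) \<longleftrightarrow> (\<forall>x\<in>B. e * x - x \<in> I \<and> x * e - x \<in> I)"
  using assms by (auto simp: is_unit_of_def carrier mult eq_iff B_closed)

lemma unital_iff: "unital M \<longleftrightarrow> (\<exists>e\<in>B. \<forall>x\<in>B. e * x - x \<in> I \<and> x * e - x \<in> I)"
proof -
  have "unital M \<longleftrightarrow> (\<exists>e\<in>B. is_unit_of M (\<pi> e))"
    unfolding unital_def by (metis carrier image_iff is_unit_of_def)
  then show ?thesis by (simp add: is_unit_of_iff)
qed

definition quasi_invertible :: "'a \<Rightarrow> bool" where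
  "quasi_invertible x \<longleftrightarrow> (\<exists>y\<in>B. x + y - x * y \<in> I \<and> x + y - y * x \<in> I)"

text \<open>Write \<open>x - z e = - z (e - x / z)\<close>. If \<open>w\<close> inverts the left
  side, then \<open>- z w\<close> inverts \<open>e - x / z\<close>, so the quasi-inverse is
  \<open>y = e + z w\<close>; conversely \<open>w = (y - e) / z\<close>. Modulo \<open>I\<close>
  every error term is a multiple of some \<open>e t - t\<close> or \<open>t e - t\<close>.\<close>

lemma unital_spectrum_iff:
  assumes e: "e \<in> B" "\<forall>x\<in>B. e * x - x \<in> I \<and> x * e - x \<in> I" and x: "x \<in> B" and z: "z \<noteq> 0"
  shows "z \<in> unital_spectrum M (\<pi> x) \<longleftrightarrow> \<not> quasi_invertible ((1/z) *\<^sub>C x)"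
proof -
  have "is_unit_of M (\<pi> e)" using is_unit_of_iff[OF e(1)] e(2) by simp
  then have u: "unit_of M = \<pi> e" by (rule unit_of_eq)
  have e1: "e * y - y \<in> I" and e2: "y * e - y \<in> I" if "y \<in> B" for y
    using e(2) that by auto
  have "z \<notin> unital_spectrum M (\<pi> x) \<longleftrightarrow>
    (\<exists>w\<in>B. (x + (- z) *\<^sub>C e) * w - e \<in> I \<and> w * (x + (- z) *\<^sub>C e) - e \<in> I)"
  proof -
    define t where "t = x + (- z) *\<^sub>C e"
    have t: "t \<in> B" unfolding t_def using x e by (intro B_add B_scaleC)
    have *: "alg_add M (\<pi> x) (alg_scale M (- z) (unit_of M)) = \<pi> t"
      by (simp only: u scale[OF e(1)] add[OF x B_scaleC[OF e(1)]] t_def)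
    have **: "alg_mult M (\<pi> t) (\<pi> w) = \<pi> e \<longleftrightarrow> t * w - e \<in> I"
      "alg_mult M (\<pi> w) (\<pi> t) = \<pi> e \<longleftrightarrow> w * t - e \<in> I" if w: "w \<in> B" for w
      by (simp_all only: mult[OF t w] mult[OF w t] eq_iff[OF B_mult[OF t w] e(1)]
          eq_iff[OF B_mult[OF w t] e(1)])
    show ?thesis
      unfolding unital_spectrum_def alg_invertible_def mem_Collect_eq * t_def[symmetric]
      unfolding u carrier using ** by auto
  qed
  also have "\<dots> \<longleftrightarrow> quasi_invertible ((1/z) *\<^sub>C x)"
    unfolding quasi_invertible_def
  proof safe
    fix w assume w: "w \<in> B" "(x + (- z) *\<^sub>C e) * w - e \<in> I" "w * (x + (- z) *\<^sub>C e) - e \<in> I"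
    show "\<exists>y\<in>B. (1/z) *\<^sub>C x + y - (1/z) *\<^sub>C x * y \<in> I \<and> (1/z) *\<^sub>C x + y - y * (1/z) *\<^sub>C x \<in> I"
    proof (intro bexI[of _ "e + z *\<^sub>C w"] conjI)
      have "(1/z) *\<^sub>C x + (e + z *\<^sub>C w) - (1/z) *\<^sub>C x * (e + z *\<^sub>C w) =
        - ((1/z) *\<^sub>C (x * e - x)) - ((x + (- z) *\<^sub>C e) * w - e) - z *\<^sub>C (e * w - w)"
        using z by (simp add: scaleC_algebra algebra_simps)
      also have "\<dots> \<in> I" by (intro I_diff[OF I_diff[OF I_minus[OF I_scaleC]]] I_scaleC e1 e2 w x)
      finally show "(1/z) *\<^sub>C x + (e + z *\<^sub>C w) - (1/z) *\<^sub>C x * (e + z *\<^sub>C w) \<in> I" .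
      have "(1/z) *\<^sub>C x + (e + z *\<^sub>C w) - (e + z *\<^sub>C w) * (1/z) *\<^sub>C x =
        - ((1/z) *\<^sub>C (e * x - x)) - (w * (x + (- z) *\<^sub>C e) - e) - z *\<^sub>C (w * e - w)"
        using z by (simp add: scaleC_algebra algebra_simps)
      also have "\<dots> \<in> I" by (intro I_diff[OF I_diff[OF I_minus[OF I_scaleC]]] I_scaleC e1 e2 w x)
      finally show "(1/z) *\<^sub>C x + (e + z *\<^sub>C w) - (e + z *\<^sub>C w) * (1/z) *\<^sub>C x \<in> I" .
    qed (use e w in \<open>auto intro: B_closed\<close>)
  next
    fix y assume y: "y \<in> B" "(1/z) *\<^sub>C x + y - (1/z) *\<^sub>C x * y \<in> I"
      "(1/z) *\<^sub>C x + y - y * (1/z) *\<^sub>C x \<in> I"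
    show "\<exists>w\<in>B. (x + (- z) *\<^sub>C e) * w - e \<in> I \<and> w * (x + (- z) *\<^sub>C e) - e \<in> I"
    proof (intro bexI[of _ "(1/z) *\<^sub>C (y - e)"] conjI)
      have "(x + (- z) *\<^sub>C e) * (1/z) *\<^sub>C (y - e) - e =
        - ((1/z) *\<^sub>C x + y - (1/z) *\<^sub>C x * y) - (1/z) *\<^sub>C (x * e - x) - (e * y - y) + (e * e - e)"
        using z by (simp add: scaleC_algebra algebra_simps)
      also have "\<dots> \<in> I" by (intro I_add[OF I_diff[OF I_diff[OF I_minus]]] I_scaleC e1 e2 e(1) y x)
      finally show "(x + (- z) *\<^sub>C e) * (1/z) *\<^sub>C (y - e) - e \<in> I" .
      have "(1/z) *\<^sub>C (y - e) * (x + (- z) *\<^sub>C e) - e =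
        - ((1/z) *\<^sub>C x + y - y * (1/z) *\<^sub>C x) - (1/z) *\<^sub>C (e * x - x) - (y * e - y) + (e * e - e)"
        using z by (simp add: scaleC_algebra algebra_simps)
      also have "\<dots> \<in> I" by (intro I_add[OF I_diff[OF I_diff[OF I_minus]]] I_scaleC e1 e2 e(1) y x)
      finally show "(1/z) *\<^sub>C (y - e) * (x + (- z) *\<^sub>C e) - e \<in> I" .
    qed (use e y in \<open>auto intro: B_closed\<close>)
  qed
  finally show ?thesis by blast
qed

text \<open>In an inverse \<open>(w, c)\<close> of \<open>(x, - z)\<close> the scalar part forces
  \<open>c = - 1 / z\<close>, and what is left says that \<open>z w\<close> is a quasi-inverse of
  \<open>x / z\<close>.\<close>

lemma unitization_spectrum_iff:
  assumes x: "x \<in> B" and z: "z \<noteq> 0"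
  shows "z \<in> unital_spectrum (unitization M) (\<pi> x, 0) \<longleftrightarrow> \<not> quasi_invertible ((1/z) *\<^sub>C x)"
proof -
  have 1: "is_unit_of (unitization M) (\<pi> 0, 1)"
    by (auto simp: is_unit_of_def unitization_def carrier add mult scale B_closed)
  have "z \<notin> unital_spectrum (unitization M) (\<pi> x, 0) \<longleftrightarrow>
    (\<exists>w\<in>B. \<exists>c. (x * w + ((- z) *\<^sub>C w + c *\<^sub>C x) \<in> I \<and> w * x + (c *\<^sub>C x + (- z) *\<^sub>C w) \<in> I) \<and> - z * c = 1)"
    using x
    by (simp add: unital_spectrum_def alg_invertible_def unit_of_eq[OF 1])
      (auto simp: unitization_def carrier add mult scale eq_iff B_closed mult.commute)
  also have "\<dots> \<longleftrightarrow> quasi_invertible ((1/z) *\<^sub>C x)"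
    unfolding quasi_invertible_def
  proof safe
    fix w c assume w: "w \<in> B" "x * w + ((- z) *\<^sub>C w + c *\<^sub>C x) \<in> I"
      "w * x + (c *\<^sub>C x + (- z) *\<^sub>C w) \<in> I" and zc: "- z * c = 1"
    have "c * z = -1" using arg_cong[OF zc, of uminus] by (simp add: mult.commute)
    then have c: "c = - (1/z)" using z by (simp add: field_simps)
    show "\<exists>y\<in>B. (1/z) *\<^sub>C x + y - (1/z) *\<^sub>C x * y \<in> I \<and> (1/z) *\<^sub>C x + y - y * (1/z) *\<^sub>C x \<in> I"
    proof (intro bexI[of _ "z *\<^sub>C w"] conjI)
      show "(1/z) *\<^sub>C x + z *\<^sub>C w - (1/z) *\<^sub>C x * z *\<^sub>C w \<in> I"
        using I_minus[OF w(2)] z by (simp add: c scaleC_algebra algebra_simps)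
      show "(1/z) *\<^sub>C x + z *\<^sub>C w - z *\<^sub>C w * (1/z) *\<^sub>C x \<in> I"
        using I_minus[OF w(3)] z by (simp add: c scaleC_algebra algebra_simps)
    qed (use w in \<open>auto intro: B_closed\<close>)
  next
    fix y assume y: "y \<in> B" "(1/z) *\<^sub>C x + y - (1/z) *\<^sub>C x * y \<in> I"
      "(1/z) *\<^sub>C x + y - y * (1/z) *\<^sub>C x \<in> I"
    show "\<exists>w\<in>B. \<exists>c. (x * w + ((- z) *\<^sub>C w + c *\<^sub>C x) \<in> I \<and>
      w * x + (c *\<^sub>C x + (- z) *\<^sub>C w) \<in> I) \<and> - z * c = 1"
    proof (intro bexI[of _ "(1/z) *\<^sub>C y"] exI[of _ "- (1/z)"] conjI)
      show "x * (1/z) *\<^sub>C y + ((- z) *\<^sub>C (1/z) *\<^sub>C y + (- (1/z)) *\<^sub>C x) \<in> I"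
        using I_minus[OF y(2)] z by (simp add: scaleC_algebra algebra_simps)
      show "(1/z) *\<^sub>C y * x + ((- (1/z)) *\<^sub>C x + (- z) *\<^sub>C (1/z) *\<^sub>C y) \<in> I"
        using I_minus[OF y(3)] z by (simp add: scaleC_algebra algebra_simps)
    qed (use y z in \<open>auto intro: B_closed\<close>)
  qed
  finally show ?thesis by blast
qed

text \<open>For nonzero \<open>z\<close> both branches of \<open>spectrum\<close> reduce to the same
  condition, so no later argument has to ask whether a quotient has a unit.\<close>

lemma spectrum_iff:
  assumes "x \<in> B" "z \<noteq> 0"
  shows "z \<in> spectrum M (\<pi> x) \<longleftrightarrow> \<not> quasi_invertible ((1/z) *\<^sub>C x)"
proof (cases "unital M")
  case True
  then obtain e where "e \<in> B" "\<forall>x\<in>B. e * x - x \<in> I \<and> x * e - x \<in> I"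
    using unital_iff by auto
  then show ?thesis using unital_spectrum_iff assms True by (simp add: spectrum_def)
next
  case False
  then show ?thesis using unitization_spectrum_iff assms by (simp add: spectrum_def)
qed

end

section \<open>Subalgebras and quotients by closed ideals as instances\<close>

definition subalgebra :: "'a::cstar_algebra set \<Rightarrow> bool" where
  "subalgebra B \<longleftrightarrow> 0 \<in> B \<and> (\<forall>x\<in>B. \<forall>y\<in>B. x + y \<in> B \<and> x * y \<in> B) \<and> (\<forall>c. \<forall>x\<in>B. c *\<^sub>C x \<in> B)"

lemma subalgebra_UNIV [simp]: "subalgebra UNIV"
  by (simp add: subalgebra_def)

lemma alg_quotient_subalg:
  assumes "subalgebra B"
  shows "alg_quotient (subalg B) (\<lambda>x. x) B {0}"
  using assms by unfold_locales (auto simp: subalg_def subalgebra_def)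

lemma closed_ideal_minus: "closed_ideal B I \<Longrightarrow> x \<in> I \<Longrightarrow> - x \<in> I"
  unfolding closed_ideal_def by (metis scaleC_minus_one)

lemma closed_ideal_diff: "closed_ideal B I \<Longrightarrow> x \<in> I \<Longrightarrow> y \<in> I \<Longrightarrow> x - y \<in> I"
  using closed_ideal_minus[of B I y] unfolding closed_ideal_def by (metis diff_conv_add_uminus)

text \<open>The operations of \<open>quotient_alg\<close> are unions over all representatives;
  well-definedness means that these are unions of one and the same coset.\<close>

lemma UN_eq_const: "X \<noteq> {} \<Longrightarrow> (\<And>x. x \<in> X \<Longrightarrow> F x = C) \<Longrightarrow> (\<Union>x\<in>X. F x) = C"
  by auto

lemma alg_quotient_quotient_alg:
  fixes B :: "'a::cstar_algebra set"
  assumes B: "subalgebra B" and I: "closed_ideal B I"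
  shows "alg_quotient (quotient_alg (subalg B) I) (alg_coset (subalg B) I) B I"
proof -
  let ?p = "\<lambda>x. (+) x ` I"
  have p: "alg_coset (subalg B) I = ?p"
    by (simp add: alg_coset_def subalg_def fun_eq_iff)
  have IB: "I \<subseteq> B" and I0: "0 \<in> I" and Iadd: "\<And>x y. x \<in> I \<Longrightarrow> y \<in> I \<Longrightarrow> x + y \<in> I"
    and Isc: "\<And>x c. x \<in> I \<Longrightarrow> c *\<^sub>C x \<in> I"
    and Im: "\<And>b x. b \<in> B \<Longrightarrow> x \<in> I \<Longrightarrow> b * x \<in> I" "\<And>b x. b \<in> B \<Longrightarrow> x \<in> I \<Longrightarrow> x * b \<in> I"
    using I by (auto simp: closed_ideal_def)
  have eq: "?p x = ?p y \<longleftrightarrow> x - y \<in> I" for x y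
  proof
    assume "?p x = ?p y"
    moreover have "x \<in> ?p x" using I0 by (auto simp: image_iff)
    ultimately show "x - y \<in> I" by auto
  next
    assume xy: "x - y \<in> I"
    show "?p x = ?p y"
    proof safe
      fix i assume "i \<in> I"
      then show "x + i \<in> ?p y" using Iadd[OF xy, of i]
        by (intro image_eqI[of _ _ "x - y + i"]) (auto simp: algebra_simps)
      show "y + i \<in> ?p x"
        using closed_ideal_diff[OF I \<open>i \<in> I\<close> xy]
        by (intro image_eqI[of _ _ "i - (x - y)"]) (auto simp: algebra_simps)
    qed
  qed
  have ne: "?p x \<noteq> {}" for x using I0 by auto
  let ?Q = "quotient_alg (subalg B) I"
  have q: "alg_carrier ?Q = ?p ` B" "alg_zero ?Q = I"
    "alg_add ?Q X Y = (\<Union>u\<in>X. \<Union>v\<in>Y. ?p (u + v))" "alg_mult ?Q X Y = (\<Union>u\<in>X. \<Union>v\<in>Y. ?p (u * v))"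
    "alg_scale ?Q c X = (\<Union>u\<in>X. ?p (c *\<^sub>C u))" for X Y c
    unfolding quotient_alg_def subalg_def alg_coset_def by simp_all
  show ?thesis
  proof (unfold_locales, goal_cases)
    case (3 x y)
    have "(\<Union>u\<in>?p x. \<Union>v\<in>?p y. ?p (u + v)) = ?p (x + y)"
    proof (intro UN_eq_const ne)
      fix u v assume "u \<in> ?p x" "v \<in> ?p y"
      then obtain i j where ij: "i \<in> I" "j \<in> I" "u = x + i" "v = y + j" by auto
      then have "(u + v) - (x + y) \<in> I" using Iadd[of i j] by (simp add: algebra_simps)
      then show "?p (u + v) = ?p (x + y)" by (simp only: eq)
    qed
    then show ?case unfolding p q .
  next
    case (4 x y)
    have "(\<Union>u\<in>?p x. \<Union>v\<in>?p y. ?p (u * v)) = ?p (x * y)"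
    proof (intro UN_eq_const ne)
      fix u v assume "u \<in> ?p x" "v \<in> ?p y"
      then obtain i j where ij: "i \<in> I" "j \<in> I" "u = x + i" "v = y + j" by auto
      have "u * v - x * y = i * y + (x * j + i * j)" by (simp add: ij algebra_simps)
      also have "\<dots> \<in> I" using ij 4 IB by (intro Iadd Im) auto
      finally show "?p (u * v) = ?p (x * y)" by (simp only: eq)
    qed
    then show ?case unfolding p q .
  next
    case (5 x c)
    have "(\<Union>u\<in>?p x. ?p (c *\<^sub>C u)) = ?p (c *\<^sub>C x)"
    proof (intro UN_eq_const ne)
      fix u assume "u \<in> ?p x"
      then obtain i where i: "i \<in> I" "u = x + i" by auto
      then have "c *\<^sub>C u - c *\<^sub>C x \<in> I" using Isc[of i c] by (simp add: scaleC.add_right)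
      then show "?p (c *\<^sub>C u) = ?p (c *\<^sub>C x)" by (simp only: eq)
    qed
    then show ?case unfolding p q .
  next
    case (6 x y)
    show ?case unfolding p by (rule eq)
  next
    case 1
    show ?case unfolding p q ..
  next
    case 2
    have "(+) 0 ` I = I" by simp
    then show ?case unfolding p q ..
  next
    case 7
    show ?case using B by (simp add: subalgebra_def)
  next
    case (8 x y)
    then show ?case using B by (simp add: subalgebra_def)
  next
    case (9 x y)
    then show ?case using B by (simp add: subalgebra_def)
  next
    case (10 x c)
    then show ?case using B by (simp add: subalgebra_def)
  next
    case 11
    show ?case by (rule I0)
  next
    case (12 x y)
    then show ?case by (rule Iadd)
  next
    case (13 x c)
    then show ?case by (rule Isc)
  qed
qed

lemma spectrum_subalg_iff:
  assumes "subalgebra B" "x \<in> B" "z \<noteq> 0"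
  shows "z \<in> spectrum (subalg B) x \<longleftrightarrow> \<not> (\<exists>y\<in>B. qinv ((1/z) *\<^sub>C x) y)"
proof -
  interpret alg_quotient "subalg B" "\<lambda>x. x" B "{0}" by (rule alg_quotient_subalg) fact
  show ?thesis using spectrum_iff[OF assms(2,3)] by (simp add: quasi_invertible_def qinv_def)
qed

lemma spectrum_quotient_iff:
  assumes "subalgebra B" "closed_ideal B I" "x \<in> B" "z \<noteq> 0"
  shows "z \<in> spectrum (quotient_alg (subalg B) I) (alg_coset (subalg B) I x) \<longleftrightarrow>
    \<not> (\<exists>y\<in>B. (1/z) *\<^sub>C x + y - ((1/z) *\<^sub>C x) * y \<in> I \<and> (1/z) *\<^sub>C x + y - y * ((1/z) *\<^sub>C x) \<in> I)"
proof -
  interpret alg_quotient "quotient_alg (subalg B) I" "alg_coset (subalg B) I" B I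
    by (rule alg_quotient_quotient_alg) fact+
  show ?thesis using spectrum_iff[OF assms(3,4)] by (simp add: quasi_invertible_def)
qed

lemma unital_quotient_iff:
  assumes "subalgebra B" "closed_ideal B I"
  shows "unital (quotient_alg (subalg B) I) \<longleftrightarrow>
    (\<exists>e\<in>B. \<forall>x\<in>B. e * x - x \<in> I \<and> x * e - x \<in> I)"
proof -
  interpret alg_quotient "quotient_alg (subalg B) I" "alg_coset (subalg B) I" B I
    by (rule alg_quotient_quotient_alg) fact+
  show ?thesis by (rule unital_iff)
qed

section \<open>Polynomials in a positive element\<close>

text \<open>The unitization again, now as a type of class \<open>ring_1\<close>, so that factoring
  polynomials in \<open>a\<close> becomes ring algebra. A new unit is adjoined even if the algebra
  already has one.\<close>

datatype 'a unitized = Unitized (vpart: 'a) (spart: complex)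

instantiation unitized :: (cstar_algebra) ring_1
begin

definition "0 = Unitized 0 0"
definition "1 = Unitized 0 1"
definition "u + v = Unitized (vpart u + vpart v) (spart u + spart v)"
definition "u - v = Unitized (vpart u - vpart v) (spart u - spart v)"
definition "- u = Unitized (- vpart u) (- spart u)"
definition "u * v = Unitized (vpart u * vpart v + (spart u *\<^sub>C vpart v + spart v *\<^sub>C vpart u)) (spart u * spart v)"

lemmas unitized_defs = zero_unitized_def one_unitized_def plus_unitized_def minus_unitized_def
  uminus_unitized_def times_unitized_def

instance
  by standard (auto simp: unitized_defs scaleC_algebra algebra_simps)

end

lemma unitized_part_simps [simp]:
  "vpart (0::'a unitized) = 0" "spart (0::'a unitized) = 0"
  "vpart (1::'a unitized) = 0" "spart (1::'a unitized) = 1"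
  "vpart (u + v) = vpart u + vpart v" "spart (u + v) = spart u + spart v"
  "vpart (u - v) = vpart u - vpart v" "spart (u - v) = spart u - spart v"
  "vpart (- u) = - vpart u" "spart (- u) = - spart u"
  "vpart (u * v) = vpart u * vpart v + (spart u *\<^sub>C vpart v + spart v *\<^sub>C vpart u)"
  "spart (u * v) = spart u * spart v"
  for u v :: "'a::cstar_algebra unitized"
  by (simp_all add: unitized_defs)

lemma unitized_eq_iff: "u = v \<longleftrightarrow> vpart u = vpart v \<and> spart u = spart v"
  by (cases u; cases v) simp

abbreviation emb :: "'a::cstar_algebra \<Rightarrow> 'a unitized" where "emb x \<equiv> Unitized x 0"
abbreviation scalar :: "complex \<Rightarrow> 'a::cstar_algebra unitized" where "scalar c \<equiv> Unitized 0 c"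

lemma scalar_commute: "scalar c * u = u * scalar c"
  by (simp add: unitized_eq_iff)

definition invertible_unitized :: "'a::cstar_algebra unitized \<Rightarrow> bool" where
  "invertible_unitized u \<longleftrightarrow> (\<exists>v. u * v = 1 \<and> v * u = 1)"

lemma invertible_unitized_mult:
  assumes "invertible_unitized u" "invertible_unitized v"
  shows "invertible_unitized (u * v)"
proof -
  obtain u' v' where "u * u' = 1" "u' * u = 1" "v * v' = 1" "v' * v = 1"
    using assms by (auto simp: invertible_unitized_def)
  then have "(u * v) * (v' * u') = 1" "(v' * u') * (u * v) = 1"
    by (metis mult.assoc mult_1_right)+
  then show ?thesis unfolding invertible_unitized_def by blast
qed

text \<open>If \<open>w\<close> inverts \<open>u * v = v * u\<close>, then \<open>v * w\<close> is a
  right and \<open>w * v\<close> a left inverse of \<open>u\<close>, so they agree. Used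
  contrapositively: a noninvertible factor \<open>a - z\<close> makes a polynomial in
  \<open>a\<close> noninvertible.\<close>

lemma invertible_unitized_of_commuting_mult:
  assumes "invertible_unitized (u * v)" "u * v = v * u"
  shows "invertible_unitized u"
proof -
  obtain w where w: "(u * v) * w = 1" "w * (u * v) = 1"
    using assms by (auto simp: invertible_unitized_def)
  have r: "u * (v * w) = 1" using w by (simp add: mult.assoc)
  have l: "(w * v) * u = 1" using w assms by (simp add: mult.assoc)
  have "w * v = (w * v) * (u * (v * w))" by (simp add: r)
  also have "\<dots> = v * w" by (simp add: mult.assoc[symmetric] l[unfolded mult.assoc[symmetric]])
  finally show ?thesis using r l unfolding invertible_unitized_def by metis
qed

lemma invertible_scalar: "c \<noteq> 0 \<Longrightarrow> invertible_unitized (scalar c :: 'a::cstar_algebra unitized)"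
  unfolding invertible_unitized_def by (intro exI[of _ "scalar (1/c)"]) (simp add: unitized_eq_iff)

lemma invertible_emb_minus_scalar_iff:
  assumes z: "z \<noteq> 0"
  shows "invertible_unitized (emb x - scalar z) \<longleftrightarrow> (\<exists>y. qinv ((1/z) *\<^sub>C x) y)"
proof
  assume "invertible_unitized (emb x - scalar z)"
  then obtain w c where w: "(emb x - scalar z) * Unitized w c = 1"
    "Unitized w c * (emb x - scalar z) = 1"
    unfolding invertible_unitized_def by (metis unitized.collapse)
  then have zc: "- z * c = 1" and 1: "x * w + ((- z) *\<^sub>C w + c *\<^sub>C x) = 0"
    and 2: "w * x + (c *\<^sub>C x + (- z) *\<^sub>C w) = 0"
    by (simp_all add: unitized_eq_iff)
  have "c * z = -1" using arg_cong[OF zc, of uminus] by (simp add: mult.commute)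
  then have c: "c = - (1/z)" using z by (simp add: field_simps)
  show "\<exists>y. qinv ((1/z) *\<^sub>C x) y"
  proof (intro exI)
    show "qinv ((1/z) *\<^sub>C x) (z *\<^sub>C w)"
      using 1 2 z by (simp add: qinv_def c scaleC_algebra algebra_simps eq_neg_iff_add_eq_0)
  qed
next
  assume "\<exists>y. qinv ((1/z) *\<^sub>C x) y"
  then obtain y where y: "(1/z) *\<^sub>C x + y = (1/z) *\<^sub>C (x * y)" "(1/z) *\<^sub>C x + y = (1/z) *\<^sub>C (y * x)"
    by (auto simp: qinv_def)
  have "(1/z) *\<^sub>C (x * y) - y - (1/z) *\<^sub>C x = 0" "(1/z) *\<^sub>C (y * x) - y - (1/z) *\<^sub>C x = 0"
    using y by (simp_all add: algebra_simps)
  then show "invertible_unitized (emb x - scalar z)"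
    unfolding invertible_unitized_def using z
    by (intro exI[of _ "Unitized ((1/z) *\<^sub>C y) (- (1/z))"])
      (simp add: unitized_eq_iff scaleC_algebra algebra_simps)
qed

text \<open>Horner's scheme. The values lie in the unitization because \<open>p - \<mu>\<close> and
  the linear factors \<open>X - z\<close> have constant terms.\<close>

definition poly_at :: "'a::cstar_algebra \<Rightarrow> complex poly \<Rightarrow> 'a unitized" where
  "poly_at a p = fold_coeffs (\<lambda>c r. scalar c + emb a * r) p 0"

lemma poly_at_0 [simp]: "poly_at a 0 = 0"
  by (simp add: poly_at_def)

lemma poly_at_pCons [simp]: "poly_at a (pCons c p) = scalar c + emb a * poly_at a p"
proof (cases "p = 0 \<and> c = 0")
  case True
  then show ?thesis by (simp add: unitized_eq_iff)
qed (auto simp: poly_at_def)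

lemma poly_at_add: "poly_at a (p + q) = poly_at a p + poly_at a q"
proof (induction p q rule: poly_induct2)
  case (pCons c p d q)
  then show ?case by (simp add: unitized_eq_iff scaleC_algebra algebra_simps)
qed simp

lemma poly_at_smult: "poly_at a (smult c p) = scalar c * poly_at a p"
  by (induction p) (simp_all add: unitized_eq_iff scaleC_algebra algebra_simps)

lemma poly_at_mult: "poly_at a (p * q) = poly_at a p * poly_at a q"
proof (induction p)
  case (pCons c p)
  then show ?case
    by (simp add: mult_pCons_left poly_at_add poly_at_smult distrib_right mult.assoc)
      (simp add: unitized_eq_iff)
qed simp

lemma poly_at_diff: "poly_at a (p - q) = poly_at a p - poly_at a q"
  using poly_at_add[of a "p - q" q] by simp

lemma spart_poly_at [simp]: "spart (poly_at a p) = poly p 0"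
  by (induction p) auto

text \<open>Over the complex numbers \<open>p\<close> splits into linear factors, and the factors
  \<open>a - \<xi>\<close> are invertible. Contrapositively, a spectral value \<open>\<mu>\<close>
  of \<open>q(a)\<close> is \<open>q(\<xi>)\<close> for some \<open>\<xi>\<close> with
  \<open>a - \<xi>\<close> not invertible.\<close>

lemma poly_at_spectral_mapping:
  assumes "p \<noteq> 0" "\<And>\<xi>. poly p \<xi> = 0 \<Longrightarrow> invertible_unitized (emb a - scalar \<xi>)"
  shows "invertible_unitized (poly_at a p)"
  using assms
proof (induction "degree p" arbitrary: p)
  case 0
  then obtain c where "p = [:c:]" "c \<noteq> 0" by (metis degree_eq_zeroE pCons_0_0)
  then show ?case using invertible_scalar[of c] by (simp add: unitized_eq_iff flip: zero_unitized_def)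
next
  case (Suc n)
  then have "\<not> constant (poly p)" by (simp add: constant_degree)
  then obtain r where r: "poly p r = 0" using fundamental_theorem_of_algebra by blast
  then obtain q where q: "p = [:- r, 1:] * q" by (auto simp: poly_eq_0_iff_dvd)
  have q0: "q \<noteq> 0" using q Suc.prems(1) by auto
  then have "degree p = Suc (degree q)" unfolding q by (subst degree_mult_eq) auto
  then have "invertible_unitized (poly_at a q)" using Suc q q0 by auto
  moreover have "poly_at a [:- r, 1:] = emb a - scalar r" by (simp add: unitized_eq_iff)
  ultimately show ?case
    unfolding q poly_at_mult using Suc.prems(2)[OF r] by (simp only: invertible_unitized_mult)
qed

text \<open>Evaluation is only used for polynomials without constant term, where nothing is lost.\<close>

definition eval_poly :: "'a::cstar_algebra \<Rightarrow> complex poly \<Rightarrow> 'a" where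
  "eval_poly a p = vpart (poly_at a p)"

lemma eval_poly_simps:
  "eval_poly a (p + q) = eval_poly a p + eval_poly a q"
  "eval_poly a (p - q) = eval_poly a p - eval_poly a q"
  "eval_poly a (smult c p) = c *\<^sub>C eval_poly a p"
  "poly p 0 = 0 \<Longrightarrow> poly q 0 = 0 \<Longrightarrow> eval_poly a (p * q) = eval_poly a p * eval_poly a q"
  "eval_poly a [:0, 1:] = a"
  by (simp_all add: eval_poly_def poly_at_add poly_at_diff poly_at_smult poly_at_mult)

lemma emb_poly_at_commute: "emb a * poly_at a p = poly_at a p * emb a"
proof (induction p)
  case (pCons c p)
  have "emb a * poly_at a (pCons c p) = scalar c * emb a + emb a * (emb a * poly_at a p)"
    by (simp only: poly_at_pCons distrib_left scalar_commute)
  also have "emb a * (emb a * poly_at a p) = (emb a * poly_at a p) * emb a"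
    by (simp only: mult.assoc pCons.IH[symmetric])
  finally show ?case by (simp only: poly_at_pCons distrib_right)
qed simp

lemma star_zero [simp]: "star (0::'a::cstar_algebra) = 0"
proof -
  have "norm (star (0::'a)) = 0" by simp
  then show ?thesis by (simp only: norm_eq_zero)
qed

definition star_unitized :: "'a::cstar_algebra unitized \<Rightarrow> 'a unitized" where
  "star_unitized u = Unitized (star (vpart u)) (cnj (spart u))"

lemma star_poly_at:
  assumes "star a = a"
  shows "poly_at a (map_poly cnj p) = star_unitized (poly_at a p)"
proof (induction p)
  case 0
  show ?case by (simp add: star_unitized_def unitized_eq_iff)
next
  case (pCons c p)
  have "poly_at a (map_poly cnj (pCons c p)) = scalar (cnj c) + emb a * star_unitized (poly_at a p)"
    by (simp add: map_poly_pCons pCons)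
  also have "\<dots> = star_unitized (scalar c + poly_at a p * emb a)"
    by (simp add: star_unitized_def unitized_eq_iff assms)
  finally show ?case by (simp add: emb_poly_at_commute)
qed

lemma eval_poly_cnj: "star a = a \<Longrightarrow> eval_poly a (map_poly cnj p) = star (eval_poly a p)"
  by (simp add: eval_poly_def star_poly_at star_unitized_def)

lemma poly_map_cnj: "poly (map_poly cnj p) z = cnj (poly p (cnj z))"
  by (induction p) (auto simp: map_poly_pCons)

lemma spectrum_UNIV_iff:
  fixes a :: "'a::cstar_algebra"
  assumes "z \<noteq> 0"
  shows "z \<in> spectrum (subalg UNIV) a \<longleftrightarrow> \<not> invertible_unitized (emb a - scalar z)"
  using spectrum_subalg_iff[of UNIV a z] invertible_emb_minus_scalar_iff[of z a] assms by simp

text \<open>Put \<open>\<mu> = p(z)\<close>. If \<open>norm (p(a)) < cmod \<mu>\<close>, then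
  \<open>p(a) - \<mu>\<close> is invertible; but \<open>X - z\<close> divides
  \<open>p - \<mu>\<close>, so \<open>a - z\<close> would be invertible too.\<close>

lemma eval_poly_lower_bound:
  assumes z: "z = 0 \<or> z \<in> spectrum (subalg UNIV) a" and p0: "poly p 0 = 0"
  shows "cmod (poly p z) \<le> norm (eval_poly a p)"
proof (rule ccontr)
  assume "\<not> ?thesis"
  then have less: "norm (eval_poly a p) < cmod (poly p z)" by simp
  define \<mu> where "\<mu> = poly p z"
  have m0: "\<mu> \<noteq> 0" using less norm_ge_zero[of "eval_poly a p"] by (auto simp: \<mu>_def simp del: norm_ge_zero)
  then have z0: "z \<noteq> 0" using p0 \<mu>_def by auto
  have "norm ((1/\<mu>) *\<^sub>C eval_poly a p) < 1"
    using less m0 by (simp add: norm_divide \<mu>_def[symmetric] field_simps)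
  then have "invertible_unitized (emb (eval_poly a p) - scalar \<mu>)"
    using qinv_small_exists invertible_emb_minus_scalar_iff[OF m0] by blast
  moreover have "emb (eval_poly a p) - scalar \<mu> = poly_at a (p - [:\<mu>:])"
    by (simp add: unitized_eq_iff poly_at_diff p0 eval_poly_def)
  moreover have "poly (p - [:\<mu>:]) z = 0" by (simp add: \<mu>_def)
  then obtain q where "p - [:\<mu>:] = [:- z, 1:] * q" unfolding poly_eq_0_iff_dvd by (rule dvdE)
  moreover have l: "poly_at a [:- z, 1:] = emb a - scalar z" by (simp add: unitized_eq_iff)
  ultimately have "invertible_unitized ((emb a - scalar z) * poly_at a q)"
    by (simp only: poly_at_mult)
  moreover have "(emb a - scalar z) * poly_at a q = poly_at a q * (emb a - scalar z)"
    by (simp only: left_diff_distrib right_diff_distrib emb_poly_at_commute scalar_commute)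
  ultimately have "invertible_unitized (emb a - scalar z)"
    by (rule invertible_unitized_of_commuting_mult)
  then show False using z z0 spectrum_UNIV_iff by blast
qed

lemma positives_UNIV_iff:
  "a \<in> positives UNIV \<longleftrightarrow> star a = a \<and> spectrum (subalg UNIV) a \<subseteq> complex_of_real ` {0..}"
  by (simp add: positives_def)

lemma spec0_iff: "t \<in> spec0 a \<longleftrightarrow> t = 0 \<or> complex_of_real t \<in> spectrum (subalg UNIV) a"
  by (simp add: spec0_def)

text \<open>\<open>p(a)\<close> need not be self-adjoint, so the spectral radius is applied to
  \<open>c = star (p(a)) * p(a) = q(a)\<close>, of norm \<open>(norm (p(a)))^2\<close>. This yields
  a spectral value of modulus \<open>norm c\<close>, equal to \<open>q(t)\<close> for a spectral
  value \<open>t\<close> of \<open>a\<close>. Since \<open>t\<close> is real, \<open>q(t)\<close> is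
  the square of \<open>cmod (p(t))\<close>.\<close>

lemma eval_poly_upper_bound:
  fixes a :: "'a::cstar_algebra"
  assumes a: "a \<in> positives UNIV" and p0: "poly p 0 = 0"
  shows "\<exists>t\<in>spec0 a. norm (eval_poly a p) \<le> cmod (poly p (of_real t))"
proof (cases "eval_poly a p = 0")
  case True
  then show ?thesis by (auto simp: spec0_iff)
next
  case False
  have sa: "star a = a" using a by (simp add: positives_UNIV_iff)
  define q where "q = map_poly cnj p * p"
  define c where "c = eval_poly a q"
  have q0: "poly q 0 = 0" by (simp add: q_def p0)
  have c: "c = star (eval_poly a p) * eval_poly a p"
    unfolding c_def q_def
    by (subst eval_poly_simps) (simp_all add: poly_map_cnj p0 eval_poly_cnj sa)
  have nc: "norm c = (norm (eval_poly a p))\<^sup>2" by (simp add: c cstar_identity)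
  then have "star c = c" "c \<noteq> 0" using False c by auto
  then obtain w where w: "cmod w = 1 / norm c" "\<not> (\<exists>y. qinv (w *\<^sub>C c) y)"
    using selfadjoint_spectral_radius by blast
  define \<mu> where "\<mu> = 1 / w"
  have m: "\<mu> \<noteq> 0" "cmod \<mu> = norm c" "1 / \<mu> = w"
    using w \<open>c \<noteq> 0\<close> by (auto simp: \<mu>_def norm_divide)
  have "\<not> invertible_unitized (emb c - scalar \<mu>)"
    using w(2) invertible_emb_minus_scalar_iff[OF m(1), of c] by (simp only: m(3)) simp
  moreover have "emb c - scalar \<mu> = poly_at a (q - [:\<mu>:])"
    by (simp add: unitized_eq_iff poly_at_diff q0 c_def eval_poly_def)
  moreover have "poly (q - [:\<mu>:]) 0 \<noteq> 0" using q0 m by simp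
  then have "q - [:\<mu>:] \<noteq> 0" by auto
  ultimately obtain \<xi> where l: "poly (q - [:\<mu>:]) \<xi> = 0" "\<not> invertible_unitized (emb a - scalar \<xi>)"
    using poly_at_spectral_mapping[of "q - [:\<mu>:]" a] by metis
  then have ql: "poly q \<xi> = \<mu>" by simp
  then have "\<xi> \<noteq> 0" using q0 m by auto
  then have ls: "\<xi> \<in> spectrum (subalg UNIV) a" using l spectrum_UNIV_iff by blast
  then obtain t where t: "\<xi> = of_real t" using a by (auto simp: positives_UNIV_iff)
  have "norm c = cmod (poly q \<xi>)" using ql m by simp
  also have "\<dots> = (cmod (poly p (of_real t)))\<^sup>2"
    by (simp add: q_def poly_map_cnj t norm_mult power2_eq_square)
  finally have "norm (eval_poly a p) = cmod (poly p (of_real t))"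
    unfolding nc by (simp add: power2_eq_iff_nonneg)
  then show ?thesis using ls t by (auto simp: spec0_iff)
qed

lemma spectrum_bounded:
  fixes a :: "'a::cstar_algebra"
  assumes "z \<in> spectrum (subalg UNIV) a"
  shows "cmod z \<le> norm a"
proof (rule ccontr)
  assume *: "\<not> ?thesis"
  then have z: "z \<noteq> 0" by auto
  have "norm ((1/z) *\<^sub>C a) < 1" using z * by (simp add: norm_divide field_simps)
  then obtain y where "qinv ((1/z) *\<^sub>C a) y" using qinv_small_exists by blast
  then show False using spectrum_subalg_iff[of UNIV a z] assms z by auto
qed

text \<open>Bounded by \<open>norm a\<close>. As 0 belongs to the set, openness of the complement
  only concerns \<open>t \<noteq> 0\<close>, where quasi-invertibility of \<open>a / t\<close>
  survives small changes of \<open>t\<close>.\<close>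

lemma compact_spec0: "compact (spec0 (a::'a::cstar_algebra))"
  unfolding compact_eq_bounded_closed
proof
  have "\<bar>t\<bar> \<le> norm a" if "t \<in> spec0 a" for t
    using that spectrum_bounded[of "of_real t" a] by (auto simp: spec0_iff)
  then show "bounded (spec0 a)" by (auto simp: bounded_iff)
  have "open (- spec0 a)"
    unfolding open_dist
  proof
    fix t assume "t \<in> - spec0 a"
    then have t: "t \<noteq> 0" "complex_of_real t \<notin> spectrum (subalg UNIV) a" by (auto simp: spec0_iff)
    then obtain y where y: "qinv ((1 / complex_of_real t) *\<^sub>C a) y"
      using spectrum_subalg_iff[of UNIV a "of_real t"] by auto
    obtain d where d: "d > 0" "\<And>x'. dist x' ((1 / complex_of_real t) *\<^sub>C a) < d \<Longrightarrow> \<exists>y'. qinv x' y'"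
      using qinv_perturb[OF y zero_less_one] by blast
    have "((\<lambda>s. (1 / complex_of_real s) *\<^sub>C a) \<longlongrightarrow> (1 / complex_of_real t) *\<^sub>C a) (at t)"
      using t by (intro scaleC.tendsto tendsto_intros) auto
    then have "\<forall>\<^sub>F s in at t. dist ((1 / complex_of_real s) *\<^sub>C a) ((1 / complex_of_real t) *\<^sub>C a) < d"
      using d(1) by (rule tendstoD)
    then obtain e where e: "e > 0" "\<And>s. s \<noteq> t \<Longrightarrow> dist s t < e \<Longrightarrow>
        dist ((1 / complex_of_real s) *\<^sub>C a) ((1 / complex_of_real t) *\<^sub>C a) < d"
      by (auto simp: eventually_at)
    show "\<exists>e>0. \<forall>s. dist s t < e \<longrightarrow> s \<in> - spec0 a"
    proof (intro exI[of _ "min e \<bar>t\<bar>"] conjI allI impI)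
      fix s assume s: "dist s t < min e \<bar>t\<bar>"
      then have "s \<noteq> 0" by (auto simp: dist_norm)
      moreover have "dist ((1 / complex_of_real s) *\<^sub>C a) ((1 / complex_of_real t) *\<^sub>C a) < d"
        using e s d(1) by (cases "s = t") auto
      ultimately show "s \<in> - spec0 a"
        using d(2) spectrum_subalg_iff[of UNIV a "of_real s"] by (auto simp: spec0_iff)
    qed (use e t in auto)
  qed
  then show "closed (spec0 a)" by (simp add: closed_def)
qed

section \<open>Continuous functional calculus\<close>

lemma bounded_linear_star: "bounded_linear (star :: 'a::cstar_algebra \<Rightarrow> 'a)"
proof
  fix r :: real and x y :: 'a
  show "star (x + y) = star x + star y" by (rule star_add)
  show "star (r *\<^sub>R x) = r *\<^sub>R star x"
    by (metis complex_cnj_complex_of_real scaleC_of_real star_scaleC)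
  show "\<exists>K. \<forall>x::'a. norm (star x) \<le> norm x * K" by (intro exI[of _ 1]) simp
qed

lemma eval_poly_norm_le:
  assumes "a \<in> positives UNIV" "poly p 0 = 0" "\<And>t. t \<in> spec0 a \<Longrightarrow> cmod (poly p (of_real t)) \<le> C"
  shows "norm (eval_poly a p) \<le> C"
  using eval_poly_upper_bound[OF assms(1,2)] assms(3) by fastforce

lemma le_eval_poly_norm:
  "poly p 0 = 0 \<Longrightarrow> t \<in> spec0 a \<Longrightarrow> cmod (poly p (of_real t)) \<le> norm (eval_poly a p)"
  using eval_poly_lower_bound[of "of_real t" a p] by (auto simp: spec0_iff)

text \<open>Weierstrass approximation of real and imaginary part within \<open>e / 4\<close> each
  gives \<open>P\<close> within \<open>e / 2\<close>. Since \<open>f 0 = 0\<close> and 0 lies in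
  \<open>spec0 a\<close>, removing the constant term of \<open>P\<close> costs less than another
  \<open>e / 2\<close>.\<close>

lemma poly_approx_C0_spec:
  assumes f: "f \<in> C0_spec a" and e: "e > 0"
  shows "\<exists>p. poly p 0 = 0 \<and> (\<forall>t\<in>spec0 a. cmod (f t - poly p (of_real t)) < e)"
proof -
  have cf: "continuous_on (spec0 a) f" and f0: "f 0 = 0" using f by (auto simp: C0_spec_def)
  have e4: "e / 4 > 0" using e by simp
  obtain g where g: "real_polynomial_function g" "\<And>t. t \<in> spec0 a \<Longrightarrow> \<bar>Re (f t) - g t\<bar> < e / 4"
    using Stone_Weierstrass_real_polynomial_function[OF compact_spec0[of a] continuous_on_Re[OF cf] e4]
    by metis
  obtain h where h: "real_polynomial_function h" "\<And>t. t \<in> spec0 a \<Longrightarrow> \<bar>Im (f t) - h t\<bar> < e / 4"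
    using Stone_Weierstrass_real_polynomial_function[OF compact_spec0[of a] continuous_on_Im[OF cf] e4]
    by metis
  obtain u m where u: "g = (\<lambda>x. \<Sum>i\<le>m. u i * x ^ i)"
    using g(1) by (auto simp: real_polynomial_function_iff_sum)
  obtain v n where v: "h = (\<lambda>x. \<Sum>i\<le>n. v i * x ^ i)"
    using h(1) by (auto simp: real_polynomial_function_iff_sum)
  define P where "P = (\<Sum>i\<le>m. monom (complex_of_real (u i)) i) +
    smult \<i> (\<Sum>i\<le>n. monom (complex_of_real (v i)) i)"
  have P: "poly P (of_real t) = of_real (g t) + \<i> * of_real (h t)" for t
    by (simp add: P_def u v poly_sum poly_monom)
  have P1: "cmod (f t - poly P (of_real t)) < e / 2" if "t \<in> spec0 a" for t
  proof -
    have "cmod (f t - poly P (of_real t)) \<le> \<bar>Re (f t) - g t\<bar> + \<bar>Im (f t) - h t\<bar>"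
      using cmod_le[of "f t - poly P (of_real t)"] by (simp add: P)
    then show ?thesis using g(2)[OF that] h(2)[OF that] by simp
  qed
  have "cmod (poly P 0) < e / 2" using P1[of 0] f0 by (simp add: spec0_def)
  show ?thesis
  proof (intro exI[of _ "P - [:poly P 0:]"] conjI ballI)
    fix t assume "t \<in> spec0 a"
    have "cmod (f t - poly P (of_real t) + poly P 0) \<le> cmod (f t - poly P (of_real t)) + cmod (poly P 0)"
      by (rule norm_triangle_ineq)
    then show "cmod (f t - poly (P - [:poly P 0:]) (of_real t)) < e"
      using P1[OF \<open>t \<in> spec0 a\<close>] \<open>cmod (poly P 0) < e / 2\<close> by (simp add: algebra_simps)
  qed simp
qed

text \<open>A relation admitting every approximating sequence, so that the algebraic laws follow by
  combining sequences termwise. That \<open>y\<close> depends only on \<open>f\<close> is a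
  consequence of the norm bound \<open>calc_rel_upper\<close>.\<close>

definition calc_rel :: "'a::cstar_algebra \<Rightarrow> (real \<Rightarrow> complex) \<Rightarrow> 'a \<Rightarrow> bool" where
  "calc_rel a f y \<longleftrightarrow> (\<exists>P. (\<forall>n. poly (P n) 0 = 0) \<and>
    uniform_limit (spec0 a) (\<lambda>n t. poly (P n) (of_real t)) f sequentially \<and>
    (\<lambda>n. eval_poly a (P n)) \<longlonglongrightarrow> y)"

lemma calc_rel_lower:
  assumes "calc_rel a f y" "t \<in> spec0 a"
  shows "cmod (f t) \<le> norm y"
proof -
  obtain P where P: "\<And>n. poly (P n) 0 = 0"
    "uniform_limit (spec0 a) (\<lambda>n t. poly (P n) (of_real t)) f sequentially"
    "(\<lambda>n. eval_poly a (P n)) \<longlonglongrightarrow> y"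
    using assms(1) by (auto simp: calc_rel_def)
  show ?thesis
  proof (rule LIMSEQ_le)
    show "(\<lambda>n. cmod (poly (P n) (of_real t))) \<longlonglongrightarrow> cmod (f t)"
      using tendsto_uniform_limitI[OF P(2) assms(2)] by (rule tendsto_norm)
    show "(\<lambda>n. norm (eval_poly a (P n))) \<longlonglongrightarrow> norm y" using P(3) by (rule tendsto_norm)
    show "\<exists>N. \<forall>n\<ge>N. cmod (poly (P n) (of_real t)) \<le> norm (eval_poly a (P n))"
      using le_eval_poly_norm[OF P(1) assms(2)] by blast
  qed
qed

lemma calc_rel_upper:
  assumes a: "a \<in> positives UNIV" and f: "calc_rel a f y" and C: "\<And>t. t \<in> spec0 a \<Longrightarrow> cmod (f t) \<le> C"
  shows "norm y \<le> C"
proof (rule field_le_epsilon)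
  fix e :: real assume e: "e > 0"
  obtain P where P: "\<And>n. poly (P n) 0 = 0"
    "uniform_limit (spec0 a) (\<lambda>n t. poly (P n) (of_real t)) f sequentially"
    "(\<lambda>n. eval_poly a (P n)) \<longlonglongrightarrow> y"
    using f by (auto simp: calc_rel_def)
  have "\<forall>\<^sub>F n in sequentially. norm (eval_poly a (P n)) \<le> C + e"
    using uniform_limitD[OF P(2) e]
  proof eventually_elim
    case (elim n)
    show ?case
    proof (rule eval_poly_norm_le[OF a P(1)])
      fix t assume t: "t \<in> spec0 a"
      have "cmod (poly (P n) (of_real t)) \<le> cmod (f t) + dist (poly (P n) (of_real t)) (f t)"
        by (metis dist_norm norm_triangle_sub)
      then show "cmod (poly (P n) (of_real t)) \<le> C + e" using elim t C[OF t] by force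
    qed
  qed
  then show "norm y \<le> C + e"
    by (rule tendsto_upperbound[OF tendsto_norm[OF P(3)]]) simp
qed

lemma calc_rel_add:
  assumes "calc_rel a f y" "calc_rel a g z"
  shows "calc_rel a (\<lambda>t. f t + g t) (y + z)"
proof -
  obtain P where P: "\<And>n. poly (P n) 0 = 0"
    "uniform_limit (spec0 a) (\<lambda>n t. poly (P n) (of_real t)) f sequentially"
    "(\<lambda>n. eval_poly a (P n)) \<longlonglongrightarrow> y"
    using assms(1) by (auto simp: calc_rel_def)
  obtain Q where Q: "\<And>n. poly (Q n) 0 = 0"
    "uniform_limit (spec0 a) (\<lambda>n t. poly (Q n) (of_real t)) g sequentially"
    "(\<lambda>n. eval_poly a (Q n)) \<longlonglongrightarrow> z"
    using assms(2) by (auto simp: calc_rel_def)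
  show ?thesis
    unfolding calc_rel_def
    using P Q by (intro exI[of _ "\<lambda>n. P n + Q n"])
      (auto simp: eval_poly_simps intro!: uniform_limit_add tendsto_add)
qed

lemma calc_rel_scaleC:
  assumes "calc_rel a f y"
  shows "calc_rel a (\<lambda>t. c * f t) (c *\<^sub>C y)"
proof -
  obtain P where P: "\<And>n. poly (P n) 0 = 0"
    "uniform_limit (spec0 a) (\<lambda>n t. poly (P n) (of_real t)) f sequentially"
    "(\<lambda>n. eval_poly a (P n)) \<longlonglongrightarrow> y"
    using assms(1) by (auto simp: calc_rel_def)
  show ?thesis
    unfolding calc_rel_def
    using P by (intro exI[of _ "\<lambda>n. smult c (P n)"])
      (auto simp: eval_poly_simps
        intro!: bounded_linear.uniform_limit[OF bounded_linear_mult_right] scaleC.tendsto)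
qed

lemma calc_rel_mult:
  assumes "calc_rel a f y" "calc_rel a g z"
  shows "calc_rel a (\<lambda>t. f t * g t) (y * z)"
proof -
  obtain P where P: "\<And>n. poly (P n) 0 = 0"
    "uniform_limit (spec0 a) (\<lambda>n t. poly (P n) (of_real t)) f sequentially"
    "(\<lambda>n. eval_poly a (P n)) \<longlonglongrightarrow> y"
    using assms(1) by (auto simp: calc_rel_def)
  obtain Q where Q: "\<And>n. poly (Q n) 0 = 0"
    "uniform_limit (spec0 a) (\<lambda>n t. poly (Q n) (of_real t)) g sequentially"
    "(\<lambda>n. eval_poly a (Q n)) \<longlonglongrightarrow> z"
    using assms(2) by (auto simp: calc_rel_def)
  \<comment> \<open>Uniform limits multiply only when bounded; the bounds come from
    \<open>calc_rel_lower\<close>.\<close>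
  have b: "bounded (f ` spec0 a)" "bounded (g ` spec0 a)"
    using calc_rel_lower assms unfolding bounded_iff by blast+
  show ?thesis
    unfolding calc_rel_def
    using P Q b by (intro exI[of _ "\<lambda>n. P n * Q n"])
      (auto simp: eval_poly_simps
        intro!: bounded_bilinear.bounded_uniform_limit[OF bounded_bilinear_mult] tendsto_mult)
qed

lemma calc_rel_cnj:
  assumes "star a = a" "calc_rel a f y"
  shows "calc_rel a (\<lambda>t. cnj (f t)) (star y)"
proof -
  obtain P where P: "\<And>n. poly (P n) 0 = 0"
    "uniform_limit (spec0 a) (\<lambda>n t. poly (P n) (of_real t)) f sequentially"
    "(\<lambda>n. eval_poly a (P n)) \<longlonglongrightarrow> y"
    using assms(2) by (auto simp: calc_rel_def)
  show ?thesis
    unfolding calc_rel_def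
    using P by (intro exI[of _ "\<lambda>n. map_poly cnj (P n)"])
      (auto simp: eval_poly_cnj[OF assms(1)] poly_map_cnj
        intro!: bounded_linear.uniform_limit[OF bounded_linear_cnj]
          bounded_linear.tendsto[OF bounded_linear_star])
qed

lemma calc_rel_poly: "poly p 0 = 0 \<Longrightarrow> calc_rel a (\<lambda>t. poly p (of_real t)) (eval_poly a p)"
  unfolding calc_rel_def by (intro exI[of _ "\<lambda>_. p"]) (auto intro!: uniform_limit_const)

lemma calc_rel_unique:
  assumes a: "a \<in> positives UNIV" and "calc_rel a f y" "calc_rel a f z"
  shows "y = z"
proof -
  have "calc_rel a (\<lambda>t. f t + (-1) * f t) (y + (-1) *\<^sub>C z)"
    using assms by (intro calc_rel_add calc_rel_scaleC)
  then have "norm (y + (-1) *\<^sub>C z) \<le> 0" by (rule calc_rel_upper[OF a]) simp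
  then show ?thesis by (simp add: scaleC_minus_one)
qed

text \<open>By \<open>eval_poly_norm_le\<close>, polynomials uniformly close on
  \<open>spec0 a\<close> have values at \<open>a\<close> that are close in norm, so an approximating
  sequence is sent to a Cauchy sequence.\<close>

lemma calc_rel_exists:
  assumes a: "a \<in> positives UNIV" and f: "f \<in> C0_spec a"
  shows "\<exists>y. calc_rel a f y"
proof -
  have "\<forall>n. \<exists>p. poly p 0 = 0 \<and> (\<forall>t\<in>spec0 a. cmod (f t - poly p (of_real t)) < inverse (real (Suc n)))"
    using poly_approx_C0_spec[OF f] by simp
  then obtain P where P: "\<And>n. poly (P n) 0 = 0"
    "\<And>n t. t \<in> spec0 a \<Longrightarrow> cmod (f t - poly (P n) (of_real t)) < inverse (real (Suc n))"
    by metis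
  have lim: "uniform_limit (spec0 a) (\<lambda>n t. poly (P n) (of_real t)) f sequentially"
  proof (rule uniform_limitI)
    fix e :: real assume "e > 0"
    have "\<forall>\<^sub>F n in sequentially. inverse (real (Suc n)) < e"
      using LIMSEQ_inverse_real_of_nat \<open>e > 0\<close> by (rule order_tendstoD(2))
    then show "\<forall>\<^sub>F n in sequentially. \<forall>t\<in>spec0 a. dist (poly (P n) (of_real t)) (f t) < e"
    proof eventually_elim
      case (elim n)
      then show ?case
        using P(2)[of _ n] by (auto simp: dist_norm norm_minus_commute intro: less_trans)
    qed
  qed
  have "Cauchy (\<lambda>n. eval_poly a (P n))"
  proof (rule metric_CauchyI)
    fix e :: real assume "e > 0"
    then obtain N where N: "\<And>n. n \<ge> N \<Longrightarrow> inverse (real (Suc n)) < e / 3"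
      using order_tendstoD(2)[OF LIMSEQ_inverse_real_of_nat, of "e / 3"]
      by (auto simp: eventually_sequentially)
    have "dist (eval_poly a (P m)) (eval_poly a (P n)) < e" if "m \<ge> N" "n \<ge> N" for m n
    proof -
      have "norm (eval_poly a (P m - P n)) \<le> 2 * e / 3"
      proof (rule eval_poly_norm_le[OF a])
        fix t assume t: "t \<in> spec0 a"
        have "cmod (poly (P m) (of_real t) - poly (P n) (of_real t)) \<le>
          cmod (f t - poly (P n) (of_real t)) + cmod (f t - poly (P m) (of_real t))"
          using norm_triangle_ineq4[of "f t - poly (P n) (of_real t)" "f t - poly (P m) (of_real t)"]
          by simp
        then show "cmod (poly (P m - P n) (of_real t)) \<le> 2 * e / 3"
          using P(2)[OF t, of m] P(2)[OF t, of n] N[OF that(1)] N[OF that(2)] by simp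
      qed (use P in simp)
      then show ?thesis using \<open>e > 0\<close> by (simp add: eval_poly_simps dist_norm)
    qed
    then show "\<exists>N. \<forall>m\<ge>N. \<forall>n\<ge>N. dist (eval_poly a (P m)) (eval_poly a (P n)) < e" by blast
  qed
  then obtain y where "(\<lambda>n. eval_poly a (P n)) \<longlonglongrightarrow> y"
    using Cauchy_convergent convergent_def by blast
  then show ?thesis using P(1) lim unfolding calc_rel_def by blast
qed

section \<open>The calculus as an isometric homomorphism, and its uniqueness\<close>

definition cfc :: "'a::cstar_algebra \<Rightarrow> (real \<Rightarrow> complex) \<Rightarrow> 'a" where
  "cfc a f = (THE y. calc_rel a f y)"

lemma calc_rel_cfc_iff:
  assumes "a \<in> positives UNIV" "f \<in> C0_spec a"
  shows "calc_rel a f y \<longleftrightarrow> cfc a f = y"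
  unfolding cfc_def using calc_rel_exists[OF assms] calc_rel_unique[OF assms(1)]
  by (metis the_equality)

lemma C0_spec_intros:
  "f \<in> C0_spec a \<Longrightarrow> g \<in> C0_spec a \<Longrightarrow> (\<lambda>t. f t + g t) \<in> C0_spec a"
  "f \<in> C0_spec a \<Longrightarrow> g \<in> C0_spec a \<Longrightarrow> (\<lambda>t. f t - g t) \<in> C0_spec a"
  "f \<in> C0_spec a \<Longrightarrow> g \<in> C0_spec a \<Longrightarrow> (\<lambda>t. f t * g t) \<in> C0_spec a"
  "f \<in> C0_spec a \<Longrightarrow> (\<lambda>t. c * f t) \<in> C0_spec a"
  "f \<in> C0_spec a \<Longrightarrow> (\<lambda>t. cnj (f t)) \<in> C0_spec a"
  "complex_of_real \<in> C0_spec a"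
  by (auto simp: C0_spec_def intro!: continuous_intros)

context
  fixes a :: "'a::cstar_algebra"
  assumes a: "a \<in> positives UNIV"
begin

lemma cfc_add: "f \<in> C0_spec a \<Longrightarrow> g \<in> C0_spec a \<Longrightarrow> cfc a (\<lambda>t. f t + g t) = cfc a f + cfc a g"
  by (metis C0_spec_intros(1) a calc_rel_add calc_rel_cfc_iff)

lemma cfc_mult: "f \<in> C0_spec a \<Longrightarrow> g \<in> C0_spec a \<Longrightarrow> cfc a (\<lambda>t. f t * g t) = cfc a f * cfc a g"
  by (metis C0_spec_intros(3) a calc_rel_mult calc_rel_cfc_iff)

lemma cfc_scaleC: "f \<in> C0_spec a \<Longrightarrow> cfc a (\<lambda>t. c * f t) = c *\<^sub>C cfc a f"
  by (metis C0_spec_intros(4) a calc_rel_scaleC calc_rel_cfc_iff)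

lemma cfc_diff:
  assumes "f \<in> C0_spec a" "g \<in> C0_spec a"
  shows "cfc a (\<lambda>t. f t - g t) = cfc a f - cfc a g"
  using cfc_add[OF C0_spec_intros(2)[OF assms] assms(2)] by (simp add: algebra_simps)

lemma cfc_cnj: "f \<in> C0_spec a \<Longrightarrow> cfc a (\<lambda>t. cnj (f t)) = star (cfc a f)"
  using a by (metis C0_spec_intros(5) positives_UNIV_iff calc_rel_cnj calc_rel_cfc_iff)

lemma cfc_id: "cfc a complex_of_real = a"
proof -
  have "calc_rel a (\<lambda>t. poly [:0, 1:] (complex_of_real t)) (eval_poly a [:0, 1:])"
    by (rule calc_rel_poly) simp
  then have "calc_rel a complex_of_real a" by (simp add: eval_poly_simps(5))
  then show ?thesis using calc_rel_cfc_iff[OF a C0_spec_intros(6)] by simp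
qed

lemma cfc_norm_le:
  "f \<in> C0_spec a \<Longrightarrow> (\<And>t. t \<in> spec0 a \<Longrightarrow> cmod (f t) \<le> C) \<Longrightarrow> norm (cfc a f) \<le> C"
  using calc_rel_upper[OF a] calc_rel_cfc_iff[OF a] by metis

lemma cfc_norm_ge: "f \<in> C0_spec a \<Longrightarrow> t \<in> spec0 a \<Longrightarrow> cmod (f t) \<le> norm (cfc a f)"
  using calc_rel_lower calc_rel_cfc_iff[OF a] by metis

lemma is_functional_calculus_cfc: "is_functional_calculus a (cfc a)"
proof -
  have "norm (cfc a f) = (SUP t\<in>spec0 a. cmod (f t))" if f: "f \<in> C0_spec a" for f
  proof (rule antisym)
    have "bdd_above ((\<lambda>t. cmod (f t)) ` spec0 a)"
      using cfc_norm_ge[OF f] by (rule bdd_aboveI2)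
    then show "norm (cfc a f) \<le> (SUP t\<in>spec0 a. cmod (f t))"
      using f by (intro cfc_norm_le cSUP_upper)
    show "(SUP t\<in>spec0 a. cmod (f t)) \<le> norm (cfc a f)"
      using cfc_norm_ge[OF f] by (intro cSUP_least) (auto simp: spec0_def)
  qed
  then show ?thesis
    unfolding is_functional_calculus_def by (simp add: cfc_add cfc_mult cfc_scaleC cfc_cnj cfc_id)
qed

text \<open>The induction runs over functions \<open>t * q(t)\<close> because a nonzero constant is
  not in \<open>C0_spec a\<close>: the plain Horner recursion would leave the domain of the
  calculus.\<close>

lemma functional_calculus_poly:
  assumes "is_functional_calculus a \<Phi>"
  shows "\<Phi> (\<lambda>t. complex_of_real t * poly q (complex_of_real t)) = eval_poly a (pCons 0 q)"
proof (induction q)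
  case 0
  have "\<Phi> (\<lambda>t. 0 * complex_of_real t) = 0 *\<^sub>C \<Phi> complex_of_real"
    using assms C0_spec_intros(6) unfolding is_functional_calculus_def by blast
  then show ?case by (simp add: eval_poly_def)
next
  case (pCons c r)
  have h: "\<Phi> complex_of_real = a"
    and s: "\<And>f c. f \<in> C0_spec a \<Longrightarrow> \<Phi> (\<lambda>t. c * f t) = c *\<^sub>C \<Phi> f"
    and p: "\<And>f g. f \<in> C0_spec a \<Longrightarrow> g \<in> C0_spec a \<Longrightarrow> \<Phi> (\<lambda>t. f t + g t) = \<Phi> f + \<Phi> g"
    and m: "\<And>f g. f \<in> C0_spec a \<Longrightarrow> g \<in> C0_spec a \<Longrightarrow> \<Phi> (\<lambda>t. f t * g t) = \<Phi> f * \<Phi> g"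
    using assms unfolding is_functional_calculus_def by blast+
  have i: "complex_of_real \<in> C0_spec a" by (rule C0_spec_intros)
  have j: "(\<lambda>t. complex_of_real t * poly r (complex_of_real t)) \<in> C0_spec a"
    by (auto simp: C0_spec_def intro!: continuous_intros)
  have "\<Phi> (\<lambda>t. c * complex_of_real t + complex_of_real t * (complex_of_real t * poly r (complex_of_real t)))
    = c *\<^sub>C a + a * eval_poly a (pCons 0 r)"
    using p[OF C0_spec_intros(4)[OF i] C0_spec_intros(3)[OF i j]] s[OF i] m[OF i j] h pCons by simp
  also have "\<dots> = eval_poly a (pCons 0 (pCons c r))"
    by (simp add: eval_poly_def)
  finally show ?case by (simp add: algebra_simps)
qed

text \<open>Two calculi agree on polynomials without constant term; these are uniformly dense in
  \<open>C0_spec a\<close>, and every calculus is isometric.\<close>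

lemma functional_calculus_unique:
  assumes \<Phi>: "is_functional_calculus a \<Phi>" and f: "f \<in> C0_spec a"
  shows "\<Phi> f = cfc a f"
proof -
  have p: "\<Phi> (\<lambda>t. poly p (complex_of_real t)) = cfc a (\<lambda>t. poly p (complex_of_real t))"
    if "poly p 0 = 0" for p
  proof -
    obtain c q where cq: "p = pCons c q" by (rule pCons_cases)
    then have "c = 0" using that by simp
    with cq show ?thesis
      using functional_calculus_poly[OF \<Phi>, of q] functional_calculus_poly[OF is_functional_calculus_cfc, of q]
      by simp
  qed
  have close: "norm (\<Psi> f - \<Psi> g) \<le> e"
    if \<Psi>: "is_functional_calculus a \<Psi>" and g: "g \<in> C0_spec a"
      and e: "\<And>t. t \<in> spec0 a \<Longrightarrow> cmod (f t - g t) < e" for \<Psi> g and e :: real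
  proof -
    have "\<Psi> (\<lambda>t. f t + (-1) * g t) = \<Psi> f + (-1) *\<^sub>C \<Psi> g"
      using \<Psi> f g C0_spec_intros(4)[OF g, of "-1"] unfolding is_functional_calculus_def by metis
    moreover have "norm (\<Psi> (\<lambda>t. f t + (-1) * g t)) = (SUP t\<in>spec0 a. cmod (f t + (-1) * g t))"
      using \<Psi> C0_spec_intros(1)[OF f C0_spec_intros(4)[OF g, of "-1"]]
      unfolding is_functional_calculus_def by blast
    moreover have "(SUP t\<in>spec0 a. cmod (f t + (-1) * g t)) \<le> e"
      using e by (intro cSUP_least) (auto simp: spec0_def less_imp_le)
    ultimately show ?thesis by (simp add: scaleC_minus_one)
  qed
  have "dist (\<Phi> f) (cfc a f) \<le> e" if e: "e > 0" for e
  proof -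
    obtain q where q: "poly q 0 = 0" "\<And>t. t \<in> spec0 a \<Longrightarrow> cmod (f t - poly q (of_real t)) < e / 2"
      using poly_approx_C0_spec[OF f, of "e / 2"] e by auto
    let ?g = "\<lambda>t. poly q (complex_of_real t)"
    have g: "?g \<in> C0_spec a" using q by (auto simp: C0_spec_def intro!: continuous_intros)
    have "norm (\<Phi> f - \<Phi> ?g) \<le> e / 2" "norm (cfc a f - cfc a ?g) \<le> e / 2"
      using close[OF \<Phi> g q(2)] close[OF is_functional_calculus_cfc g q(2)] by simp_all
    then show ?thesis
      using dist_triangle_le[of "\<Phi> f" "\<Phi> ?g" "cfc a f" e] by (simp add: p[OF q(1)] dist_norm norm_minus_commute)
  qed
  then show ?thesis by (metis dist_le_zero_iff field_le_epsilon add_0)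
qed

text \<open>The description has a single solution for two reasons: all calculi agree at
  \<open>f\<close>, and there is at least one, without which every \<open>y\<close> would
  qualify.\<close>

lemma func_calc_eq_cfc:
  assumes "(\<lambda>t. complex_of_real (f t)) \<in> C0_spec a"
  shows "func_calc f a = cfc a (\<lambda>t. complex_of_real (f t))"
  unfolding func_calc_def
  by (rule the_equality) (use functional_calculus_unique[OF _ assms] is_functional_calculus_cfc in blast)+

text \<open>On the spectrum, \<open>f(t)\<close> is uniformly close to \<open>t k(t) t\<close> for \<open>k(t) = f(t) / max(t, \<delta>)\<^sup>2\<close>.\<close>

lemma cfc_approx_sandwich:
  assumes f: "f \<in> C0_spec a" and e: "e > 0"
  shows "\<exists>k\<in>C0_spec a. norm (cfc a f - a * cfc a k * a) < e"
proof -
  have cf: "continuous_on (spec0 a) f" and f0: "f 0 = 0" using f by (auto simp: C0_spec_def)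
  have nonneg: "t \<ge> 0" if "t \<in> spec0 a" for t
    using a that by (auto simp: spec0_iff positives_UNIV_iff)
  have "0 \<in> spec0 a" by (simp add: spec0_def)
  then obtain d where d: "d > 0" "\<And>t. t \<in> spec0 a \<Longrightarrow> dist t 0 < d \<Longrightarrow> dist (f t) (f 0) < e / 2"
    using cf e unfolding continuous_on_iff by (metis half_gt_zero)
  define k where "k = (\<lambda>t. f t / complex_of_real ((max t d)\<^sup>2))"
  have k: "k \<in> C0_spec a"
  proof -
    have "max t d \<noteq> 0" for t using d(1) by (simp add: max_def)
    then show ?thesis
      using cf f0 unfolding k_def C0_spec_def by (auto intro!: continuous_intros)
  qed
  note i = C0_spec_intros(6)[of a]
  have "cfc a (\<lambda>t. f t - complex_of_real t * (k t * complex_of_real t)) = cfc a f - a * cfc a k * a"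
    by (simp add: cfc_diff[OF f C0_spec_intros(3)[OF i C0_spec_intros(3)[OF k i]]]
        cfc_mult[OF i C0_spec_intros(3)[OF k i]] cfc_mult[OF k i] cfc_id mult.assoc)
  moreover have "norm (cfc a (\<lambda>t. f t - complex_of_real t * (k t * complex_of_real t))) \<le> e / 2"
  proof (rule cfc_norm_le)
    show "(\<lambda>t. f t - complex_of_real t * (k t * complex_of_real t)) \<in> C0_spec a"
      using f k i by (intro C0_spec_intros)
    fix t assume t: "t \<in> spec0 a"
    show "cmod (f t - complex_of_real t * (k t * complex_of_real t)) \<le> e / 2"
    proof (cases "t < d")
      case True
      have "f t - complex_of_real t * (k t * complex_of_real t) = f t * complex_of_real (1 - (t / d)\<^sup>2)"
        using True d(1) by (simp add: k_def power2_eq_square algebra_simps)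
      then have "cmod (f t - complex_of_real t * (k t * complex_of_real t)) = cmod (f t) * \<bar>1 - (t / d)\<^sup>2\<bar>"
        by (simp add: norm_mult del: of_real_diff of_real_power of_real_divide)
      also have "\<dots> \<le> cmod (f t) * 1"
        using True d(1) nonneg[OF t] by (intro mult_left_mono) (auto simp: abs_le_iff power_le_one)
      also have "\<dots> \<le> e / 2" using d(2)[OF t] True nonneg[OF t] f0 by (simp add: dist_norm)
      finally show ?thesis .
    next
      case False
      then have "f t - complex_of_real t * (k t * complex_of_real t) = 0"
        using d(1) by (simp add: k_def power2_eq_square)
      then show ?thesis using e by simp
    qed
  qed
  ultimately show ?thesis using k e by (intro bexI[of _ k]) auto
qed

end

section \<open>Hereditary subalgebras and ideals\<close>

lemma closure_map_into_closed:
  assumes "continuous_on UNIV F" "closed T" "\<And>s. s \<in> S \<Longrightarrow> F s \<in> T" "x \<in> closure S"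
  shows "F x \<in> T"
  using image_closure_subset[of S F T] assms continuous_on_subset[of UNIV F] by blast

lemma closure_map2_into_closed:
  fixes F :: "'a::metric_space \<Rightarrow> 'a \<Rightarrow> 'b::metric_space"
  assumes "continuous_on UNIV (\<lambda>p. F (fst p) (snd p))" "closed T"
    and "\<And>s t. s \<in> S \<Longrightarrow> t \<in> S \<Longrightarrow> F s t \<in> T" "x \<in> closure S" "y \<in> closure S"
  shows "F x y \<in> T"
  using closure_map_into_closed[OF assms(1,2), of "S \<times> S" "(x, y)"] assms(3-) by (auto simp: closure_Times)

definition hered :: "'a::cstar_algebra \<Rightarrow> 'a set" where
  "hered a = closure (range (\<lambda>y. a * y * a))"

lemma closed_hered: "closed (hered a)"
  by (simp add: hered_def)

lemma sandwich_in_hered: "a * y * a \<in> hered a"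
  unfolding hered_def by (rule subsetD[OF closure_subset]) auto

text \<open>Heredity in multiplicative form: the middle factor comes from the whole algebra.\<close>

lemma hered_mult_mult:
  assumes "x \<in> hered a" "y \<in> hered a"
  shows "x * w * y \<in> hered a"
proof (rule closure_map2_into_closed[where F = "\<lambda>x y. x * w * y"])
  show "closed (hered a)" by (rule closed_hered)
  fix s t assume "s \<in> range (\<lambda>y. a * y * a)" "t \<in> range (\<lambda>y. a * y * a)"
  then obtain u v where "s = a * u * a" "t = a * v * a" by blast
  then have "s * w * t = a * (u * a * w * a * v) * a" by (simp add: mult.assoc)
  then show "s * w * t \<in> hered a" by (simp only: sandwich_in_hered)
qed (use assms in \<open>auto simp: hered_def intro!: continuous_intros\<close>)

lemma subalgebra_hered: "subalgebra (hered a)"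
  unfolding subalgebra_def
proof (intro conjI ballI allI)
  show "0 \<in> hered a" using sandwich_in_hered[of a 0] by simp
  fix x assume x: "x \<in> hered a"
  show "c *\<^sub>C x \<in> hered a" for c
  proof (rule closure_map_into_closed[where F = "scaleC c"])
    show "continuous_on UNIV (scaleC c :: 'a \<Rightarrow> 'a)"
      by (intro scaleC.continuous_on continuous_intros)
    fix s assume "s \<in> range (\<lambda>y. a * y * a)"
    then obtain u where "s = a * u * a" by blast
    then have "c *\<^sub>C s = a * (c *\<^sub>C u) * a" by simp
    then show "c *\<^sub>C s \<in> hered a" by (simp only: sandwich_in_hered)
  qed (use x in \<open>auto simp: hered_def\<close>)
  fix y assume y: "y \<in> hered a"
  show "x + y \<in> hered a"
  proof (rule closure_map2_into_closed[where F = "(+)"])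
    fix s t assume "s \<in> range (\<lambda>y. a * y * a)" "t \<in> range (\<lambda>y. a * y * a)"
    then obtain u v where "s = a * u * a" "t = a * v * a" by blast
    then have "s + t = a * (u + v) * a" by (simp add: algebra_simps)
    then show "s + t \<in> hered a" by (simp only: sandwich_in_hered)
  qed (use x y in \<open>auto simp: hered_def intro!: continuous_intros\<close>)
  show "x * y \<in> hered a"
  proof (rule closure_map2_into_closed[where F = "(*)"])
    fix s t assume "s \<in> range (\<lambda>y. a * y * a)" "t \<in> range (\<lambda>y. a * y * a)"
    then obtain u v where "s = a * u * a" "t = a * v * a" by blast
    then have "s * t = a * (u * a * a * v) * a" by (simp add: mult.assoc)
    then show "s * t \<in> hered a" by (simp only: sandwich_in_hered)
  qed (use x y in \<open>auto simp: hered_def intro!: continuous_intros\<close>)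
qed

lemma hered_diff:
  assumes "x \<in> hered a" "y \<in> hered a"
  shows "x - y \<in> hered a"
proof -
  have "x + (-1) *\<^sub>C y \<in> hered a" using assms subalgebra_hered[of a] unfolding subalgebra_def by blast
  then show ?thesis by (simp add: scaleC_minus_one)
qed

lemma hered_mult: "x \<in> hered a \<Longrightarrow> y \<in> hered a \<Longrightarrow> x * y \<in> hered a"
  using subalgebra_hered[of a] unfolding subalgebra_def by blast

lemma cfc_in_hered:
  assumes "a \<in> positives UNIV" "f \<in> C0_spec a"
  shows "cfc a f \<in> hered a"
  unfolding hered_def closure_approachable
  using cfc_approx_sandwich[OF assms] by (fastforce simp: dist_norm norm_minus_commute)

lemma self_in_hered: "a \<in> positives UNIV \<Longrightarrow> a \<in> hered a"
  using cfc_in_hered[OF _ C0_spec_intros(6), of a] cfc_id[of a] by simp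

text \<open>The spectrum is taken in \<open>hered a\<close>, so quasi-inverses must be found there.
  That of \<open>f / z\<close> is \<open>f / (f - z)\<close>, which vanishes at 0; applied to
  \<open>a\<close> it therefore stays in \<open>hered a\<close>.\<close>

lemma cfc_in_positives_hered:
  assumes a: "a \<in> positives UNIV" and f: "(\<lambda>t. complex_of_real (f t)) \<in> C0_spec a"
    and nonneg: "\<And>t. f t \<ge> 0"
  shows "cfc a (\<lambda>t. complex_of_real (f t)) \<in> positives (hered a)"
proof -
  let ?b = "cfc a (\<lambda>t. complex_of_real (f t))"
  have b: "?b \<in> hered a" by (rule cfc_in_hered[OF a f])
  have "star ?b = ?b" using cfc_cnj[OF a f] by simp
  moreover have "z \<in> complex_of_real ` {0..}" if z: "z \<in> spectrum (subalg (hered a)) ?b" for z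
  proof (rule ccontr)
    assume nz: "z \<notin> complex_of_real ` {0..}"
    then have z0: "z \<noteq> 0" by force
    have fz: "complex_of_real (f t) - z \<noteq> 0" for t using nz nonneg[of t] by auto
    define g where "g = (\<lambda>t. complex_of_real (f t) / (complex_of_real (f t) - z))"
    have g: "g \<in> C0_spec a" using f fz unfolding g_def C0_spec_def
      by (auto intro!: continuous_intros)
    have e: "(1/z) * complex_of_real (f t) + g t = (1/z) * (complex_of_real (f t) * g t)" for t
      using z0 fz[of t] by (simp add: g_def field_simps)
    have s: "(1/z) *\<^sub>C ?b + cfc a g = cfc a (\<lambda>t. (1/z) * complex_of_real (f t) + g t)"
      by (simp only: cfc_add[OF a C0_spec_intros(4)[OF f] g] cfc_scaleC[OF a f])
    have m1: "(1/z) *\<^sub>C ?b * cfc a g = cfc a (\<lambda>t. (1/z) * (complex_of_real (f t) * g t))"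
      by (simp only: cfc_mult[OF a f g] cfc_scaleC[OF a C0_spec_intros(3)[OF f g]] mult_scaleC_left)
    have m2: "cfc a g * (1/z) *\<^sub>C ?b = cfc a (\<lambda>t. (1/z) * (complex_of_real (f t) * g t))"
      by (simp only: mult.commute[of "complex_of_real (f _)"] cfc_mult[OF a g f]
          cfc_scaleC[OF a C0_spec_intros(3)[OF g f]] mult_scaleC_right)
    have "qinv ((1/z) *\<^sub>C ?b) (cfc a g)"
      unfolding qinv_def s m1 m2 e by simp
    then show False
      using spectrum_subalg_iff[OF subalgebra_hered b z0] z cfc_in_hered[OF a g] by blast
  qed
  ultimately show ?thesis using b by (auto simp: positives_def)
qed

text \<open>A quasi-inverse in \<open>B\<close> is also one in the whole algebra, so passing to the
  latter can only shrink the nonzero spectrum.\<close>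

lemma positives_subset_UNIV:
  assumes "subalgebra B"
  shows "positives B \<subseteq> positives UNIV"
proof
  fix b assume b: "b \<in> positives B"
  have "z \<in> complex_of_real ` {0..}" if "z \<in> spectrum (subalg UNIV) b" for z
  proof (cases "z = 0")
    case False
    then have "z \<in> spectrum (subalg B) b"
      using that b spectrum_subalg_iff[OF assms, of b z] spectrum_subalg_iff[of UNIV b z]
      by (auto simp: positives_def)
    then show ?thesis using b by (auto simp: positives_def)
  qed force
  then show "b \<in> positives UNIV" using b by (auto simp: positives_def)
qed

section \<open>The distance to a closed ideal as quotient norm\<close>

lemma closed_idealD:
  assumes "closed_ideal B I"
  shows "I \<subseteq> B" "closed I" "0 \<in> I" "x \<in> I \<Longrightarrow> y \<in> I \<Longrightarrow> x + y \<in> I" "x \<in> I \<Longrightarrow> c *\<^sub>C x \<in> I"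
    "b \<in> B \<Longrightarrow> x \<in> I \<Longrightarrow> b * x \<in> I" "b \<in> B \<Longrightarrow> x \<in> I \<Longrightarrow> x * b \<in> I"
  using assms unfolding closed_ideal_def by blast+

lemma infdist_le_of_all:
  assumes "I \<noteq> {}" "\<And>i. i \<in> I \<Longrightarrow> c \<le> dist x i"
  shows "c \<le> infdist x I"
  using assms by (simp add: infdist_notempty cINF_greatest)

lemma infdist_ideal_add:
  assumes I: "closed_ideal B I"
  shows "infdist (x + y) I \<le> infdist x I + infdist y I"
proof -
  note i = closed_idealD[OF I]
  have "infdist (x + y) I - infdist x I \<le> dist y j" if j: "j \<in> I" for j
  proof -
    have "infdist (x + y) I - dist y j \<le> dist x k" if k: "k \<in> I" for k
    proof -
      have "infdist (x + y) I \<le> dist (x + y) (k + j)" using i(4)[OF k j] by (rule infdist_le)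
      then show ?thesis using dist_triangle_add[of x y k j] by simp
    qed
    then have "infdist (x + y) I - dist y j \<le> infdist x I" using i(3) by (intro infdist_le_of_all) auto
    then show ?thesis by simp
  qed
  then have "infdist (x + y) I - infdist x I \<le> infdist y I" using i(3) by (intro infdist_le_of_all) auto
  then show ?thesis by simp
qed

lemma infdist_ideal_cong:
  assumes I: "closed_ideal B I" and "x - y \<in> I"
  shows "infdist x I \<le> infdist y I"
  using infdist_ideal_add[OF I, of "x - y" y] assms(2) by simp

lemma infdist_ideal_mult:
  assumes I: "closed_ideal B I" and y: "y \<in> B"
  shows "infdist (x * y) I \<le> infdist x I * norm y"
proof (cases "y = 0")
  case False
  note i = closed_idealD[OF I]
  have "infdist (x * y) I / norm y \<le> dist x j" if j: "j \<in> I" for j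
  proof -
    have "infdist (x * y) I \<le> dist (x * y) (j * y)" using i(7)[OF y j] by (rule infdist_le)
    also have "\<dots> \<le> dist x j * norm y"
      using norm_mult_ineq[of "x - j" y] by (simp add: dist_norm left_diff_distrib)
    finally show ?thesis using False by (simp add: field_simps)
  qed
  then have "infdist (x * y) I / norm y \<le> infdist x I" using i(3) by (intro infdist_le_of_all) auto
  then show ?thesis using False by (simp add: field_simps)
qed (use closed_idealD(3)[OF I] in auto)

lemma in_ideal_iff_infdist: "closed_ideal B I \<Longrightarrow> x \<in> I \<longleftrightarrow> infdist x I = 0"
  using in_closed_iff_infdist_zero[of I x] closed_idealD(2,3)[of B I] by auto

context
  fixes a :: "'a::cstar_algebra" and I :: "'a set"
  assumes a: "a \<in> positives UNIV" and I: "closed_ideal UNIV I"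
begin

text \<open>
  Let \<open>q\<close> be the quotient norm.  If \<open>y\<close> is a quasi-inverse of \<open>a / z\<close> modulo \<open>I\<close>, then
  \<open>q(h(a)) \<le> (1 + \<parallel>y\<parallel>) q(h\<^sub>1(a))\<close> with \<open>h\<^sub>1(t) = h(t) (1 - t / z)\<close>.  On a small interval around \<open>z\<close> the
  factor \<open>1 - t / z\<close> is small, and iterating gives \<open>q(h(a)) = 0\<close>.
\<close>

lemma cfc_in_ideal_local:
  assumes z: "z > 0" and y: "(1 / complex_of_real z) *\<^sub>C a + y - ((1 / complex_of_real z) *\<^sub>C a) * y \<in> I"
  shows "\<exists>d>0. \<forall>h. continuous_on UNIV h \<and> h 0 = 0 \<and> (\<forall>t. h t \<noteq> 0 \<longrightarrow> z - d < t \<and> t < z + d) \<longrightarrow> cfc a h \<in> I"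
proof -
  define K where "K = 1 + norm y"
  \<comment> \<open>For \<open>t\<close> within \<open>d\<close> of \<open>z\<close> the factor
    \<open>1 - t / z\<close> is at most \<open>1 / (2 * K)\<close> in modulus; against the loss
    \<open>K\<close> per round, a gain of 1/2 remains.\<close>
  define d where "d = z / (2 * K)"
  have K: "K \<ge> 1" by (simp add: K_def)
  have d: "d > 0" using z K by (simp add: d_def)
  define good where "good = (\<lambda>C (h :: real \<Rightarrow> complex). continuous_on UNIV h \<and> h 0 = 0 \<and>
    (\<forall>t. h t \<noteq> 0 \<longrightarrow> z - d < t \<and> t < z + d) \<and> (\<forall>t\<in>spec0 a. cmod (h t) \<le> C))"
  have C0: "h \<in> C0_spec a" if "good C h" for C h
    using that continuous_on_subset[of UNIV h "spec0 a"] by (auto simp: good_def C0_spec_def)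
  have iter: "infdist (cfc a h) I \<le> C * (1/2) ^ n" if "good C h" for n C h
    using that
  proof (induction n arbitrary: C h)
    case 0
    have "infdist (cfc a h) I \<le> dist (cfc a h) 0" using closed_idealD(3)[OF I] by (rule infdist_le)
    also have "\<dots> \<le> C" using cfc_norm_le[OF a C0[OF 0], of C] 0 by (simp add: good_def)
    finally show ?case by simp
  next
    case (Suc n)
    define h1 where "h1 = (\<lambda>t. h t - (1 / complex_of_real z) * (h t * complex_of_real t))"
    have "good (C / (2 * K)) h1"
      unfolding good_def
    proof (intro conjI allI ballI impI)
      show "continuous_on UNIV h1" "h1 0 = 0"
        using Suc.prems z by (auto simp: h1_def good_def intro!: continuous_intros)
      have "h t \<noteq> 0" if "h1 t \<noteq> 0" for t using that by (auto simp: h1_def)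
      then show "z - d < t" "t < z + d" if "h1 t \<noteq> 0" for t
        using that Suc.prems by (auto simp: good_def)
      fix t assume t: "t \<in> spec0 a"
      have C: "cmod (h t) \<le> C" using Suc.prems t by (simp add: good_def)
      show "cmod (h1 t) \<le> C / (2 * K)"
      proof (cases "h t = 0")
        case True
        then show ?thesis using C K by (simp add: h1_def)
      next
        case False
        then have "\<bar>z - t\<bar> \<le> d" using Suc.prems by (force simp: good_def)
        then have "\<bar>z - t\<bar> / z \<le> d / z" using z by (simp add: divide_right_mono)
        moreover have "\<bar>1 - t / z\<bar> = \<bar>(z - t) / z\<bar>" using z by (simp add: diff_divide_distrib)
        ultimately have "\<bar>1 - t / z\<bar> \<le> 1 / (2 * K)" using z by (simp add: d_def)
        moreover have "h1 t = h t * complex_of_real (1 - t / z)"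
          using z by (simp add: h1_def field_simps)
        then have "cmod (h1 t) = cmod (h t) * \<bar>1 - t / z\<bar>"
          by (simp add: norm_mult del: of_real_diff of_real_divide)
        ultimately show ?thesis
          using C order_trans[OF norm_ge_zero C] mult_mono[of "cmod (h t)" C "\<bar>1 - t / z\<bar>" "1 / (2 * K)"] by simp
      qed
    qed
    then have IH: "infdist (cfc a h1) I \<le> C / (2 * K) * (1/2) ^ n" by (rule Suc.IH)
    note h = C0[OF Suc.prems]
    let ?H = "cfc a h" and ?H1 = "cfc a h1" and ?x = "(1 / complex_of_real z) *\<^sub>C a"
    have "?H1 = ?H - (1 / complex_of_real z) *\<^sub>C (?H * a)"
      unfolding h1_def
      by (simp only: cfc_diff[OF a h C0_spec_intros(4)[OF C0_spec_intros(3)[OF h C0_spec_intros(6)]]]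
          cfc_scaleC[OF a C0_spec_intros(3)[OF h C0_spec_intros(6)]]
          cfc_mult[OF a h C0_spec_intros(6)] cfc_id[OF a])
    then have H1: "?H1 = ?H - ?H * ?x" by (simp only: mult_scaleC_right)
    \<comment> \<open>This is \<open>H (1 - x) (1 - y) = H - H (x + y - x y)\<close>, whose last
      term lies in \<open>I\<close> for \<open>x = a / z\<close>: multiplying \<open>h1(a)\<close>
      by \<open>1 - y\<close> recovers \<open>h(a)\<close> modulo \<open>I\<close>.\<close>
    have "H - ((H - H * x) + (H - H * x) * (- y)) = H * (x + y - x * y)" for H x
      by (simp add: algebra_simps)
    then have "?H - (?H1 + ?H1 * (- y)) = ?H * (?x + y - ?x * y)" by (simp only: H1)
    also have "\<dots> \<in> I" using closed_idealD(6)[OF I _ y] by simp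
    finally have "infdist ?H I \<le> infdist (?H1 + ?H1 * (- y)) I" by (rule infdist_ideal_cong[OF I])
    also have "\<dots> \<le> infdist ?H1 I + infdist ?H1 I * norm (- y)"
      using infdist_ideal_add[OF I] infdist_ideal_mult[OF I, of "- y" ?H1] by (metis UNIV_I add_left_mono order_trans)
    also have "\<dots> = K * infdist ?H1 I" by (simp add: K_def algebra_simps)
    also have "\<dots> \<le> K * (C / (2 * K) * (1/2) ^ n)" using IH K by (intro mult_left_mono) auto
    also have "\<dots> = C * (1/2) ^ Suc n" using K by simp
    finally show ?case .
  qed
  have "cfc a h \<in> I" if h: "continuous_on UNIV h" "h 0 = 0" "\<forall>t. h t \<noteq> 0 \<longrightarrow> z - d < t \<and> t < z + d" for h
  proof -
    have "h \<in> C0_spec a" using h continuous_on_subset[of UNIV h "spec0 a"] by (auto simp: C0_spec_def)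
    then have "good (norm (cfc a h)) h" using h cfc_norm_ge[OF a] by (auto simp: good_def)
    then have "infdist (cfc a h) I \<le> norm (cfc a h) * (1/2) ^ n" for n by (rule iter)
    moreover have "(\<lambda>n. norm (cfc a h) * (1/2) ^ n) \<longlonglongrightarrow> norm (cfc a h) * 0"
      by (intro tendsto_mult tendsto_const LIMSEQ_power_zero) simp
    ultimately have "infdist (cfc a h) I \<le> norm (cfc a h) * 0"
      by (intro LIMSEQ_le_const[of _ "norm (cfc a h) * 0"]) auto
    then show ?thesis
      using in_ideal_iff_infdist[OF I] infdist_nonneg[of "cfc a h" I] by simp
  qed
  then show ?thesis using d by blast
qed

text \<open>Compactness by bisection. The property \<open>P s t\<close> includes a margin
  \<open>r\<close> around the interval, so neighbouring intervals overlap and a function can be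
  split over them by a partition of unity.\<close>

lemma cfc_in_ideal_interval:
  assumes "0 < u" "u \<le> v"
    and y: "\<And>z. u \<le> z \<Longrightarrow> z \<le> v \<Longrightarrow>
      \<exists>y. (1 / complex_of_real z) *\<^sub>C a + y - ((1 / complex_of_real z) *\<^sub>C a) * y \<in> I"
    and h: "continuous_on UNIV h" "h 0 = 0" "\<And>t. h t \<noteq> 0 \<Longrightarrow> u \<le> t \<and> t \<le> v"
  shows "cfc a h \<in> I"
proof -
  define P where "P = (\<lambda>s t. \<exists>r>0. \<forall>h. continuous_on UNIV h \<and> h 0 = 0 \<and>
    (\<forall>x. h x \<noteq> 0 \<longrightarrow> s - r < x \<and> x < t + r) \<longrightarrow> cfc a h \<in> I)"
  have "P u v"
  proof (rule Bolzano[OF \<open>u \<le> v\<close>])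
    fix s t w assume "P s t" "P t w" and st: "s \<le> t" "t \<le> w"
    then obtain r1 r2 where r1: "r1 > 0" "\<And>h. continuous_on UNIV h \<Longrightarrow> h 0 = 0 \<Longrightarrow>
        (\<forall>x. h x \<noteq> 0 \<longrightarrow> s - r1 < x \<and> x < t + r1) \<Longrightarrow> cfc a h \<in> I"
      and r2: "r2 > 0" "\<And>h. continuous_on UNIV h \<Longrightarrow> h 0 = 0 \<Longrightarrow>
        (\<forall>x. h x \<noteq> 0 \<longrightarrow> t - r2 < x \<and> x < w + r2) \<Longrightarrow> cfc a h \<in> I"
      unfolding P_def by blast
    define r where "r = min r1 r2"
    have r: "r > 0" "r \<le> r1" "r \<le> r2" using r1 r2 by (auto simp: r_def)
    \<comment> \<open>A ramp from 1 at \<open>t - r\<close> down to 0 at \<open>t + r\<close>;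
      \<open>h * \<rho>\<close> and \<open>h * (1 - \<rho>)\<close> then live within the margins of
      the two pieces.\<close>
    define \<rho> where "\<rho> = (\<lambda>x. max 0 (min 1 ((t + r - x) / (2 * r))))"
    have c\<rho>: "continuous_on A \<rho>" for A unfolding \<rho>_def using r by (intro continuous_intros) auto
    have \<rho>0: "\<rho> x = 0" if "t + r \<le> x" for x
    proof -
      have "(t + r - x) / (2 * r) \<le> 0" using that r by (intro divide_nonpos_pos) auto
      then show ?thesis by (simp add: \<rho>_def)
    qed
    have \<rho>1: "\<rho> x = 1" if "x \<le> t - r" for x
      using that r by (simp add: \<rho>_def max_def min_def field_simps)
    have "cfc a h \<in> I" if h: "continuous_on UNIV h" "h 0 = 0"
      "\<forall>x. h x \<noteq> 0 \<longrightarrow> s - r < x \<and> x < w + r" for h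
    proof -
      define h1 where "h1 = (\<lambda>x. h x * complex_of_real (\<rho> x))"
      define h2 where "h2 = (\<lambda>x. h x * complex_of_real (1 - \<rho> x))"
      have c: "continuous_on UNIV h1" "continuous_on UNIV h2" "h1 0 = 0" "h2 0 = 0"
        using h c\<rho> by (auto simp: h1_def h2_def intro!: continuous_intros)
      have "cfc a h1 \<in> I"
      proof (rule r1(2)[OF c(1,3)], intro allI impI conjI)
        fix x assume "h1 x \<noteq> 0"
        then have "h x \<noteq> 0" "\<rho> x \<noteq> 0" by (auto simp: h1_def)
        then show "s - r1 < x" "x < t + r1" using h(3) \<rho>0[of x] r by force+
      qed
      moreover have "cfc a h2 \<in> I"
      proof (rule r2(2)[OF c(2,4)], intro allI impI conjI)
        fix x assume "h2 x \<noteq> 0"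
        then have "h x \<noteq> 0" "\<rho> x \<noteq> 1" by (auto simp: h2_def)
        then show "t - r2 < x" "x < w + r2" using h(3) \<rho>1[of x] r by force+
      qed
      moreover have "h1 \<in> C0_spec a" "h2 \<in> C0_spec a"
        using c continuous_on_subset by (auto simp: C0_spec_def)
      then have "cfc a (\<lambda>x. h1 x + h2 x) = cfc a h1 + cfc a h2" by (rule cfc_add[OF a])
      moreover have "(\<lambda>x. h1 x + h2 x) = h" by (simp add: h1_def h2_def fun_eq_iff algebra_simps)
      ultimately show ?thesis using closed_idealD(4)[OF I] by metis
    qed
    then show "P s w" unfolding P_def using r(1) by blast
  next
    fix z assume z: "u \<le> z" "z \<le> v"
    then obtain y where "(1 / complex_of_real z) *\<^sub>C a + y - ((1 / complex_of_real z) *\<^sub>C a) * y \<in> I"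
      using y by blast
    then obtain d where d: "d > 0" "\<And>h. continuous_on UNIV h \<Longrightarrow> h 0 = 0 \<Longrightarrow>
        (\<forall>t. h t \<noteq> 0 \<longrightarrow> z - d < t \<and> t < z + d) \<Longrightarrow> cfc a h \<in> I"
      using cfc_in_ideal_local[of z y] z assms(1) by auto
    have "P s t" if "s \<le> z \<and> z \<le> t \<and> t - s < d / 2" for s t
      unfolding P_def
    proof (intro exI[of _ "d / 2"] conjI allI impI)
      fix h :: "real \<Rightarrow> complex" assume h: "continuous_on UNIV h \<and> h 0 = 0 \<and> (\<forall>x. h x \<noteq> 0 \<longrightarrow> s - d / 2 < x \<and> x < t + d / 2)"
      have "z - d < x \<and> x < z + d" if "h x \<noteq> 0" for x
      proof -
        have "s - d / 2 < x" "x < t + d / 2" using h that by auto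
        then show ?thesis using \<open>s \<le> z \<and> z \<le> t \<and> t - s < d / 2\<close> by linarith
      qed
      then show "cfc a h \<in> I" using d(2)[of h] h by blast
    qed (use d in simp)
    then show "\<exists>d>0. \<forall>s t. s \<le> z \<and> z \<le> t \<and> t - s < d \<longrightarrow> P s t"
      using d(1) by (intro exI[of _ "d / 2"]) auto
  qed
  then obtain r where "r > 0" and r: "\<And>h. continuous_on UNIV h \<Longrightarrow> h 0 = 0 \<Longrightarrow>
      (\<forall>x. h x \<noteq> 0 \<longrightarrow> u - r < x \<and> x < v + r) \<Longrightarrow> cfc a h \<in> I"
    unfolding P_def by blast
  show ?thesis using h(3) \<open>r > 0\<close> by (intro r[OF h(1,2)]) force
qed

end

section \<open>Soft elements\<close>

lemma of_real_in_C0_spec: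
  assumes "continuous_on UNIV f" "f 0 = 0"
  shows "(\<lambda>t. complex_of_real (f t)) \<in> C0_spec a"
  using assms continuous_on_subset[of UNIV f "spec0 a"]
  by (auto simp: C0_spec_def intro!: continuous_intros)

lemma spec0_nonneg: "a \<in> positives UNIV \<Longrightarrow> t \<in> spec0 a \<Longrightarrow> 0 \<le> t"
  by (auto simp: spec0_iff positives_UNIV_iff)

lemma soft_positive_iff: "a \<in> positives UNIV \<Longrightarrow> soft a \<longleftrightarrow> soft_algebra (hered a)"
  by (simp add: soft_def hered_def positives_UNIV_iff)

lemma closed_ideal_hered_Int:
  assumes "closed_ideal UNIV I"
  shows "closed_ideal (hered a) (hered a \<inter> I)"
  using closed_idealD[OF assms] subalgebra_hered[of a] closed_hered[of a]
  unfolding closed_ideal_def subalgebra_def by (simp add: closed_Int)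

lemma soft_imp_limit_point:
  assumes a: "a \<in> positives UNIV" and "soft a" and I: "closed_ideal UNIV I" and aI: "a \<notin> I"
  shows "0 islimpt spectrum (quotient_alg (subalg UNIV) I) (alg_coset (subalg UNIV) I a)"
proof (rule ccontr)
  assume "\<not> ?thesis"
  then obtain e0 where e0: "e0 > 0" and gap: "\<And>z. z \<in> spectrum (quotient_alg (subalg UNIV) I)
      (alg_coset (subalg UNIV) I a) \<Longrightarrow> z \<noteq> 0 \<Longrightarrow> cmod z < e0 \<Longrightarrow> False"
    unfolding islimpt_approachable by auto
  have res: "\<exists>y. (1 / complex_of_real z) *\<^sub>C a + y - ((1 / complex_of_real z) *\<^sub>C a) * y \<in> I"
    if "0 < z" "z < e0" for z
    using gap[of "of_real z"] that spectrum_quotient_iff[OF subalgebra_UNIV I, of a "of_real z"] by auto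
  define \<delta> where "\<delta> = e0 / 2"
  have \<delta>: "0 < \<delta>" "\<delta> < e0" using e0 by (auto simp: \<delta>_def)
  define f where "f = (\<lambda>t. max 0 (min 1 (t / \<delta>)))"
  have cf: "continuous_on UNIV f" "f 0 = 0"
    unfolding f_def using \<delta> by (auto intro!: continuous_intros)
  have f01: "0 \<le> f t" "f t \<le> 1" for t by (auto simp: f_def)
  have fneg: "f t = 0" if "t \<le> 0" for t
    using that \<delta> divide_nonpos_pos[of t \<delta>] by (simp add: f_def)
  have fbig: "f t = 1" if "\<delta> \<le> t" for t using that \<delta> by (simp add: f_def)
  \<comment> \<open>\<open>g(a) = a - a e\<close> measures how far \<open>e = f(a)\<close> is from
    acting as a unit on \<open>a\<close>; for \<open>t >= 0\<close> it is nonzero only inside the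
    gap.\<close>
  define g where "g = (\<lambda>t. t - t * f t)"
  have cg: "continuous_on UNIV g" "g 0 = 0"
    unfolding g_def using cf by (auto intro!: continuous_intros)
  let ?f = "\<lambda>t. complex_of_real (f t)" and ?g = "\<lambda>t. complex_of_real (g t)"
  have Cf: "?f \<in> C0_spec a" and Cg: "?g \<in> C0_spec a"
    using of_real_in_C0_spec cf cg by auto
  note i = C0_spec_intros(6)[of a]
  define e where "e = cfc a ?f"
  have eB: "e \<in> hered a" unfolding e_def by (rule cfc_in_hered[OF a Cf])
  have ae: "a - a * e = cfc a ?g"
    using cfc_diff[OF a i C0_spec_intros(3)[OF i Cf]] cfc_mult[OF a i Cf] cfc_id[OF a]
    by (simp add: g_def e_def)
  have "a - e * a = cfc a ?g"
    using cfc_diff[OF a i C0_spec_intros(3)[OF Cf i]] cfc_mult[OF a Cf i] cfc_id[OF a]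
    by (simp add: g_def e_def mult.commute)
  then have ea: "e * a = a * e" using ae by (metis diff_left_imp_eq)
  have "cfc a ?g \<in> closure I"
    unfolding closure_approachable
  proof (intro allI impI)
    fix r :: real assume r: "r > 0"
    \<comment> \<open>The support of \<open>g\<close> reaches down to 0, whereas the interval lemma
      needs a positive left end. Truncating at height \<open>\<eta>\<close> moves the support into
      the interval from \<open>\<eta>\<close> to \<open>\<delta>\<close> and changes
      \<open>g(a)\<close> by at most \<open>\<eta>\<close>.\<close>
    define \<eta> where "\<eta> = min (r / 2) (\<delta> / 2)"
    have \<eta>: "0 < \<eta>" "\<eta> < r" "\<eta> < \<delta>" using r \<delta> by (auto simp: \<eta>_def)
    define h where "h = (\<lambda>t. max 0 (g t - \<eta>))"
    let ?h = "\<lambda>t. complex_of_real (h t)"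
    have ch: "continuous_on UNIV h" "h 0 = 0"
      unfolding h_def using cg \<eta> by (auto intro!: continuous_intros)
    have Ch: "?h \<in> C0_spec a" using of_real_in_C0_spec ch by auto
    have "cfc a ?h \<in> I"
    proof (rule cfc_in_ideal_interval[OF a I \<eta>(1), of \<delta>])
      show "\<exists>y. (1 / complex_of_real z) *\<^sub>C a + y - ((1 / complex_of_real z) *\<^sub>C a) * y \<in> I"
        if "\<eta> \<le> z" "z \<le> \<delta>" for z using res[of z] that \<eta> \<delta> by auto
      fix t assume "?h t \<noteq> 0"
      then have gt: "g t > \<eta>" by (simp add: h_def max_def split: if_splits)
      have t0: "t > 0" using gt \<eta> fneg[of t] by (force simp: g_def)
      have "t * f t \<ge> 0" using t0 f01[of t] by simp
      then have "\<eta> \<le> t" using gt by (simp add: g_def)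
      moreover have "t \<le> \<delta>" using gt \<eta> fbig[of t] by (force simp: g_def)
      ultimately show "\<eta> \<le> t \<and> t \<le> \<delta>" by simp
    qed (use ch \<eta> in \<open>auto intro!: continuous_intros\<close>)
    moreover have "norm (cfc a (\<lambda>t. ?h t - ?g t)) \<le> \<eta>"
    proof (rule cfc_norm_le[OF a C0_spec_intros(2)[OF Ch Cg]])
      fix t assume "t \<in> spec0 a"
      then have "t \<ge> 0" by (rule spec0_nonneg[OF a])
      then have "t * f t \<le> t * 1" using f01[of t] by (intro mult_left_mono) auto
      then have "g t \<ge> 0" by (simp add: g_def)
      then have "\<bar>h t - g t\<bar> \<le> \<eta>" using \<eta> by (auto simp: h_def)
      then show "cmod (?h t - ?g t) \<le> \<eta>" by (metis norm_of_real of_real_diff)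
    qed
    then have "dist (cfc a ?h) (cfc a ?g) < r"
      using \<eta> cfc_diff[OF a Ch Cg] by (simp add: dist_norm)
    ultimately show "\<exists>y\<in>I. dist y (cfc a ?g) < r" by blast
  qed
  then have gI: "cfc a ?g \<in> I" using closed_idealD(2)[OF I] by simp
  have unit: "e * x - x \<in> I" "x * e - x \<in> I" if "x \<in> hered a" for x
  proof -
    have aeI: "a * e - a \<in> I" using closed_ideal_minus[OF I gI] ae by (metis minus_diff_eq)
    have 1: "e * s - s \<in> I" "s * e - s \<in> I" if s: "s \<in> range (\<lambda>y. a * y * a)" for s
    proof -
      obtain w where w: "s = a * w * a" using s by blast
      have "e * s - s = (a * e - a) * (w * a)"
        by (simp add: w left_diff_distrib mult.assoc flip: ea)
      then show "e * s - s \<in> I" using closed_idealD(7)[OF I UNIV_I aeI] by simp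
      have "s * e - s = (a * w) * (a * e - a)" by (simp add: w right_diff_distrib mult.assoc)
      then show "s * e - s \<in> I" using closed_idealD(6)[OF I UNIV_I aeI] by simp
    qed
    show "e * x - x \<in> I"
      by (rule closure_map_into_closed[where F = "\<lambda>x. e * x - x", OF _ closed_idealD(2)[OF I] 1(1)])
        (use that in \<open>auto simp: hered_def intro!: continuous_intros\<close>)
    show "x * e - x \<in> I"
      by (rule closure_map_into_closed[where F = "\<lambda>x. x * e - x", OF _ closed_idealD(2)[OF I] 1(2)])
        (use that in \<open>auto simp: hered_def intro!: continuous_intros\<close>)
  qed
  define J where "J = hered a \<inter> I"
  have J: "closed_ideal (hered a) J" unfolding J_def by (rule closed_ideal_hered_Int[OF I])
  have "\<forall>x\<in>hered a. e * x - x \<in> J \<and> x * e - x \<in> J"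
    by (auto simp: J_def intro!: unit eB hered_mult hered_diff)
  then have "unital (quotient_alg (subalg (hered a)) J)"
    using unital_quotient_iff[OF subalgebra_hered J] eB by blast
  moreover have "J \<noteq> hered a" using self_in_hered[OF a] aI by (auto simp: J_def)
  ultimately show False
    using \<open>soft a\<close> J unfolding soft_positive_iff[OF a] soft_algebra_def by blast
qed

section \<open>Tent functions, cut-downs and generated ideals\<close>

lemma tent_eq: "\<epsilon> > 0 \<Longrightarrow> tent \<epsilon> t = max 0 (min t (\<epsilon> - t))"
  by (auto simp: tent_def max_def min_def)

lemma tent_zero: "tent \<epsilon> 0 = 0"
  by (simp add: tent_def)

lemma continuous_on_tent:
  assumes "\<epsilon> > 0"
  shows "continuous_on A (tent \<epsilon>)"
proof -
  have "tent \<epsilon> = (\<lambda>t. max 0 (min t (\<epsilon> - t)))" using tent_eq[OF assms] by (rule ext)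
  then show ?thesis by (simp only:) (intro continuous_intros)
qed

lemma tent_in_C0_spec: "\<epsilon> > 0 \<Longrightarrow> (\<lambda>t. complex_of_real (tent \<epsilon> t)) \<in> C0_spec a"
  by (intro of_real_in_C0_spec continuous_on_tent tent_zero)

lemma func_calc_tent:
  "a \<in> positives UNIV \<Longrightarrow> \<epsilon> > 0 \<Longrightarrow> func_calc (tent \<epsilon>) a = cfc a (\<lambda>t. complex_of_real (tent \<epsilon> t))"
  by (intro func_calc_eq_cfc tent_in_C0_spec)

lemma cut_down_in_C0_spec: "\<epsilon> > 0 \<Longrightarrow> (\<lambda>t. complex_of_real (max (t - \<epsilon>) 0)) \<in> C0_spec a"
  by (intro of_real_in_C0_spec continuous_intros) auto

lemma cut_down_eq_cfc:
  "a \<in> positives UNIV \<Longrightarrow> \<epsilon> > 0 \<Longrightarrow> cut_down a \<epsilon> = cfc a (\<lambda>t. complex_of_real (max (t - \<epsilon>) 0))"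
  unfolding cut_down_def by (intro func_calc_eq_cfc cut_down_in_C0_spec)

lemma closed_ideal_generated: "closed_ideal UNIV (generated_ideal b)"
  unfolding closed_ideal_def generated_ideal_def by (auto intro!: closed_Inter)

lemma generator_in_generated_ideal: "b \<in> generated_ideal b"
  by (simp add: generated_ideal_def)

lemma generated_ideal_least: "closed_ideal UNIV I \<Longrightarrow> b \<in> I \<Longrightarrow> generated_ideal b \<subseteq> I"
  by (auto simp: generated_ideal_def)

text \<open>A small nonzero spectral value of \<open>a + I\<close> is also one of \<open>a\<close>,
  hence a real \<open>s\<close> strictly between 0 and \<open>\<epsilon>\<close>. Since
  \<open>tent \<epsilon>\<close> does not vanish near \<open>s\<close>, the pole of
  \<open>t / (t - s)\<close> can be smoothed there at the price of an error divisible by the tent.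
  So \<open>y(a)\<close> is a quasi-inverse of \<open>a / s\<close> modulo \<open>I\<close>, a
  contradiction.\<close>

lemma limit_point_imp_ideal_below_tent:
  assumes a: "a \<in> positives UNIV"
    and lim: "\<And>I. closed_ideal UNIV I \<Longrightarrow> a \<in> I \<or>
      0 islimpt spectrum (quotient_alg (subalg UNIV) I) (alg_coset (subalg UNIV) I a)"
    and eps: "\<epsilon> > 0"
  shows "a \<lhd> func_calc (tent \<epsilon>) a"
proof (rule ccontr)
  define b where "b = cfc a (\<lambda>t. complex_of_real (tent \<epsilon> t))"
  define I where "I = generated_ideal b"
  assume "\<not> ?thesis"
  then have aI: "a \<notin> I" by (simp add: ideal_below_def I_def b_def func_calc_tent[OF a eps])
  have I: "closed_ideal UNIV I" unfolding I_def by (rule closed_ideal_generated)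
  have bI: "b \<in> I" unfolding I_def by (rule generator_in_generated_ideal)
  obtain z where z: "z \<in> spectrum (quotient_alg (subalg UNIV) I) (alg_coset (subalg UNIV) I a)"
    "z \<noteq> 0" "cmod z < \<epsilon>"
    using lim[OF I] aI eps unfolding islimpt_approachable by auto
  have nores: False if "(1/z) *\<^sub>C a + y - ((1/z) *\<^sub>C a) * y \<in> I" "(1/z) *\<^sub>C a + y - y * ((1/z) *\<^sub>C a) \<in> I" for y
    using spectrum_quotient_iff[OF subalgebra_UNIV I, of a z] z that by auto
  have "z \<in> spectrum (subalg UNIV) a"
  proof (rule ccontr)
    assume "z \<notin> spectrum (subalg UNIV) a"
    then obtain y where "qinv ((1/z) *\<^sub>C a) y" using spectrum_subalg_iff[of UNIV a z] z by auto
    then have "(1/z) *\<^sub>C a + y - ((1/z) *\<^sub>C a) * y = 0" "(1/z) *\<^sub>C a + y - y * ((1/z) *\<^sub>C a) = 0"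
      unfolding qinv_def by (metis diff_self)+
    then show False using nores closed_idealD(3)[OF I] by metis
  qed
  then obtain s where s: "z = of_real s" "0 \<le> s" using a by (auto simp: positives_UNIV_iff)
  then have s2: "0 < s" "s < \<epsilon>" using z by auto
  \<comment> \<open>Half the distance from \<open>s\<close> to the ends of the tent, so that
    \<open>tent \<epsilon> t >= d\<close> whenever \<open>t\<close> is closer than \<open>d\<close>
    to \<open>s\<close>.\<close>
  define d where "d = min s (\<epsilon> - s) / 2"
  have d: "d > 0" "2 * d \<le> s" "2 * d \<le> \<epsilon> - s" using s2 by (auto simp: d_def)
  define m where "m = (\<lambda>t. max ((t - s)\<^sup>2) (d\<^sup>2))"
  have m: "m t > 0" for t using d by (simp add: m_def less_max_iff_disj)
  text \<open>Away from \<open>s\<close>, \<open>y(t) = t / (t - s)\<close> is the quasi-inverse of \<open>t / s\<close>.\<close>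
  define y where "y = (\<lambda>t. t * (t - s) / m t)"
  define u where "u = (\<lambda>t. t / s + y t - t / s * y t)"
  \<comment> \<open>The error \<open>u\<close> vanishes off the \<open>d\<close>-neighbourhood of
    \<open>s\<close>, and inside it the maximum is the tent itself; so \<open>u\<close> is the
    product of the tent and \<open>k\<close> everywhere.\<close>
  define k where "k = (\<lambda>t. u t / max (tent \<epsilon> t) d)"
  have cm: "continuous_on UNIV m" unfolding m_def by (intro continuous_intros)
  have cy: "continuous_on UNIV y" "y 0 = 0"
    unfolding y_def using m by (auto intro!: continuous_intros cm simp: less_imp_neq[symmetric] dest: less_imp_neq)
  have cu: "continuous_on UNIV u" "u 0 = 0"
    unfolding u_def using cy s2 by (auto intro!: continuous_intros)
  have ck: "continuous_on UNIV k" "k 0 = 0"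
  proof -
    have "max (tent \<epsilon> t) d \<noteq> 0" for t using d by (auto simp: max_def)
    then show "continuous_on UNIV k"
      unfolding k_def by (intro continuous_intros cu continuous_on_tent[OF eps]) auto
  qed (simp add: k_def cu)
  have u0: "u t = 0" if "\<bar>t - s\<bar> \<ge> d" for t
  proof -
    have "d\<^sup>2 \<le> \<bar>t - s\<bar>\<^sup>2" using that d by (intro power_mono) auto
    then have "m t = (t - s) * (t - s)" by (simp add: m_def power2_eq_square)
    moreover have "t \<noteq> s" using that d by auto
    ultimately have "y t = t / (t - s)" by (simp add: y_def)
    then show ?thesis using \<open>t \<noteq> s\<close> s2 by (simp add: u_def field_simps)
  qed
  have uk: "u t = tent \<epsilon> t * k t" for t
  proof (cases "\<bar>t - s\<bar> \<ge> d")
    case True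
    then show ?thesis using u0 by (simp add: k_def)
  next
    case False
    then have "tent \<epsilon> t \<ge> d" using d by (auto simp: tent_eq[OF eps] le_max_iff_disj)
    then show ?thesis using d by (simp add: k_def max_def)
  qed
  let ?y = "\<lambda>t. complex_of_real (y t)" and ?k = "\<lambda>t. complex_of_real (k t)"
    and ?t = "\<lambda>t. complex_of_real (tent \<epsilon> t)"
  have C: "?y \<in> C0_spec a" "?k \<in> C0_spec a" "?t \<in> C0_spec a"
    using of_real_in_C0_spec cy ck tent_in_C0_spec[OF eps] by auto
  note i = C0_spec_intros(6)[of a]
  have "cfc a (\<lambda>t. ?t t * ?k t) = b * cfc a ?k" unfolding b_def by (rule cfc_mult[OF a C(3,2)])
  also have "\<dots> \<in> I" by (rule closed_idealD(7)[OF I UNIV_I bI])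
  finally have uI: "cfc a (\<lambda>t. complex_of_real (u t)) \<in> I" by (simp add: uk)
  have 1: "(1/z) *\<^sub>C a + cfc a ?y - ((1/z) *\<^sub>C a) * cfc a ?y =
    cfc a (\<lambda>t. (1/z) * complex_of_real t + ?y t - (1/z) * (complex_of_real t * ?y t))"
    by (simp only: cfc_diff[OF a C0_spec_intros(1)[OF C0_spec_intros(4)[OF i] C(1)]
          C0_spec_intros(4)[OF C0_spec_intros(3)[OF i C(1)]]]
        cfc_add[OF a C0_spec_intros(4)[OF i] C(1)] cfc_scaleC[OF a i]
        cfc_scaleC[OF a C0_spec_intros(3)[OF i C(1)]] cfc_mult[OF a i C(1)] cfc_id[OF a] mult_scaleC_left)
  have 2: "(1/z) *\<^sub>C a + cfc a ?y - cfc a ?y * ((1/z) *\<^sub>C a) =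
    cfc a (\<lambda>t. (1/z) * complex_of_real t + ?y t - (1/z) * (?y t * complex_of_real t))"
    by (simp only: cfc_diff[OF a C0_spec_intros(1)[OF C0_spec_intros(4)[OF i] C(1)]
          C0_spec_intros(4)[OF C0_spec_intros(3)[OF C(1) i]]]
        cfc_add[OF a C0_spec_intros(4)[OF i] C(1)] cfc_scaleC[OF a i]
        cfc_scaleC[OF a C0_spec_intros(3)[OF C(1) i]] cfc_mult[OF a C(1) i] cfc_id[OF a] mult_scaleC_right)
  have 3: "(1/z) * complex_of_real t + ?y t - (1/z) * (complex_of_real t * ?y t) = complex_of_real (u t)"
    "(1/z) * complex_of_real t + ?y t - (1/z) * (?y t * complex_of_real t) = complex_of_real (u t)" for t
    by (simp_all add: u_def s)
  show False by (rule nores[of "cfc a ?y"]) (use uI in \<open>simp_all only: 1 2 3\<close>)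
qed

lemma tent_witness:
  assumes a: "a \<in> positives UNIV" and eps: "\<epsilon> > 0" and "a \<lhd> func_calc (tent \<epsilon>) a"
  shows "\<exists>b\<in>positives (hered a). b \<bottom> cut_down a \<epsilon> \<and> a \<lhd> b"
proof (intro bexI conjI)
  let ?b = "func_calc (tent \<epsilon>) a"
  let ?t = "\<lambda>t. complex_of_real (tent \<epsilon> t)" and ?c = "\<lambda>t. complex_of_real (max (t - \<epsilon>) 0)"
  show "a \<lhd> ?b" by fact
  show "?b \<in> positives (hered a)"
    unfolding func_calc_tent[OF a eps]
    by (rule cfc_in_positives_hered[OF a tent_in_C0_spec[OF eps]]) (simp add: tent_eq[OF eps])
  have "?b * cut_down a \<epsilon> = cfc a (\<lambda>t. ?t t * ?c t)"
    unfolding func_calc_tent[OF a eps] cut_down_eq_cfc[OF a eps]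
    by (rule cfc_mult[OF a tent_in_C0_spec[OF eps] cut_down_in_C0_spec[OF eps], symmetric])
  also have "(\<lambda>t. ?t t * ?c t) = (\<lambda>t. 0 * complex_of_real t)"
    by (auto simp: tent_def max_def)
  also have "cfc a (\<lambda>t. 0 * complex_of_real t) = 0"
    using cfc_scaleC[OF a C0_spec_intros(6), of 0] by simp
  finally show "?b \<bottom> cut_down a \<epsilon>" by (simp add: orthogonal_elts_def)
qed

text \<open>Does the work of an approximate unit: \<open>a * k\<close> with \<open>k\<close> in
  \<open>hered a\<close> almost fixes \<open>a\<close> from the left.\<close>

lemma approx_self_sandwich:
  assumes a: "a \<in> positives UNIV" and e: "e > 0"
  shows "\<exists>k\<in>hered a. norm (a - a * k * a) < e"
proof -
  obtain k where "k \<in> C0_spec a" "norm (cfc a complex_of_real - a * cfc a k * a) < e"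
    using cfc_approx_sandwich[OF a C0_spec_intros(6) e] by blast
  then show ?thesis using cfc_in_hered[OF a] cfc_id[OF a] by metis
qed

lemma closed_approx: "closed T \<Longrightarrow> (\<And>e. e > 0 \<Longrightarrow> \<exists>y\<in>T. norm (x - y) < e) \<Longrightarrow> x \<in> T"
  by (metis closure_approachable closure_closed dist_commute dist_norm)

text \<open>\<open>f(b)\<close> is a limit of elements \<open>b * k(b) * b\<close>, and
  \<open>k(b)\<close> lies in \<open>hered b\<close>, hence in \<open>B\<close>, the algebra in
  which \<open>J\<close> is an ideal.\<close>

lemma cfc_in_closed_ideal:
  assumes b: "b \<in> positives UNIV" and J: "closed_ideal B J" "hered b \<subseteq> B" and bJ: "b \<in> J"
    and f: "f \<in> C0_spec b"
  shows "cfc b f \<in> J"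
proof (rule closed_approx)
  show "closed J" by (rule closed_idealD[OF J(1)])
  fix e :: real assume "e > 0"
  then obtain k where k: "k \<in> C0_spec b" "norm (cfc b f - b * cfc b k * b) < e"
    using cfc_approx_sandwich[OF b f] by blast
  have "cfc b k \<in> B" using cfc_in_hered[OF b k(1)] J(2) by auto
  then have "b * cfc b k \<in> J" using closed_idealD(7)[OF J(1)] bJ by blast
  moreover have "b \<in> B" using closed_idealD(1)[OF J(1)] bJ by auto
  ultimately have "b * cfc b k * b \<in> J" using closed_idealD(7)[OF J(1)] by blast
  then show "\<exists>y\<in>J. norm (cfc b f - y) < e" using k(2) by blast
qed

lemma hered_mono:
  assumes "b \<in> hered a"
  shows "hered b \<subseteq> hered a"
proof -
  have "b * w * b \<in> hered a" for w using assms assms by (rule hered_mult_mult)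
  then have "range (\<lambda>w. b * w * b) \<subseteq> hered a" by auto
  then show ?thesis unfolding hered_def[of b] using closed_hered by (rule closure_minimal)
qed

text \<open>
  The point is that \<open>J\<close> is only an ideal of the hereditary subalgebra.  The elements \<open>x\<close> with
  \<open>u A x A v \<subseteq> J\<close> for all \<open>u, v\<close> in the hereditary subalgebra form an ideal of the whole algebra.
\<close>

lemma ideal_below_hereditary:
  assumes a: "a \<in> positives UNIV" and J: "closed_ideal (hered a) J"
    and b: "b \<in> positives UNIV" "b \<in> J" and ab: "a \<lhd> b"
  shows "J = hered a"
proof -
  note j = closed_idealD[OF J]
  define I where "I = {x. \<forall>w w' u v. u \<in> hered a \<longrightarrow> v \<in> hered a \<longrightarrow> u * w * x * w' * v \<in> J}"
  have "closed_ideal UNIV I"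
    unfolding closed_ideal_def
  proof (intro conjI ballI allI)
    have "closed {x. u * w * x * w' * v \<in> J}" for u w w' v
    proof -
      have "closed ((\<lambda>x. u * w * x * w' * v) -` J)"
        by (intro closed_vimage[OF j(2)] continuous_intros)
      then show ?thesis by (simp add: vimage_def)
    qed
    then show "closed I" unfolding I_def by (intro closed_Collect_all closed_Collect_imp) auto
    show "0 \<in> I" using j(3) by (simp add: I_def)
    fix x assume x: "x \<in> I"
    show "x + y \<in> I" if "y \<in> I" for y
      using x that j(4) by (simp add: I_def distrib_left distrib_right)
    show "c *\<^sub>C x \<in> I" for c
      using x j(5) by (simp add: I_def)
    fix c
    have "u * w * (c * x) * w' * v = u * (w * c) * x * w' * v"
      "u * w * (x * c) * w' * v = u * w * x * (c * w') * v" for u w w' v by (simp_all add: mult.assoc)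
    then show "c * x \<in> I" "x * c \<in> I" using x by (simp_all add: I_def)
  qed simp
  moreover have "b \<in> I"
    unfolding I_def
  proof (intro CollectI allI impI)
    fix u v w w' assume uv: "u \<in> hered a" "v \<in> hered a"
    have bB: "b \<in> hered a" using b j(1) by auto
    \<comment> \<open>Replace \<open>b\<close> by \<open>b * k(b) * b\<close>: the outer blocks
      \<open>u * w * b\<close> and \<open>b * w' * v\<close> lie in the hereditary subalgebra, and
      \<open>k(b)\<close> lies in \<open>J\<close>.\<close>
    show "u * w * b * w' * v \<in> J"
    proof (rule closed_approx[OF j(2)])
      fix e :: real assume e: "e > 0"
      define N where "N = 1 + norm (u * w) * norm (w' * v)"
      have N: "N > 0" by (simp add: N_def add_pos_nonneg)
      have "e / N > 0" using e N by simp
      then obtain k where k: "k \<in> C0_spec b" "norm (cfc b complex_of_real - b * cfc b k * b) < e / N"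
        using cfc_approx_sandwich[OF b(1) C0_spec_intros(6)] by blast
      have kJ: "cfc b k \<in> J" by (rule cfc_in_closed_ideal[OF b(1) J hered_mono[OF bB] b(2) k(1)])
      have "(u * w * b) * cfc b k \<in> J" by (rule j(6)[OF hered_mult_mult[OF uv(1) bB] kJ])
      then have "(u * w * b) * cfc b k * (b * w' * v) \<in> J"
        by (rule j(7)[OF hered_mult_mult[OF bB uv(2)]])
      moreover have "norm (u * w * b * w' * v - (u * w * b) * cfc b k * (b * w' * v)) < e"
      proof -
        have "u * w * b * w' * v - (u * w * b) * cfc b k * (b * w' * v) =
          (u * w) * (b - b * cfc b k * b) * (w' * v)"
          by (simp add: left_diff_distrib right_diff_distrib mult.assoc)
        also have "norm \<dots> \<le> norm ((u * w) * (b - b * cfc b k * b)) * norm (w' * v)"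
          by (rule norm_mult_ineq)
        also have "\<dots> \<le> (norm (u * w) * norm (b - b * cfc b k * b)) * norm (w' * v)"
          by (intro mult_right_mono norm_mult_ineq) simp
        also have "\<dots> = norm (u * w) * norm (w' * v) * norm (b - b * cfc b k * b)" by simp
        also have "\<dots> \<le> N * norm (b - b * cfc b k * b)" by (intro mult_right_mono) (simp_all add: N_def)
        also have "\<dots> < N * (e / N)" using k(2) N cfc_id[OF b(1)] by (intro mult_strict_left_mono) auto
        finally show ?thesis using N by simp
      qed
      ultimately show "\<exists>y\<in>J. norm (u * w * b * w' * v - y) < e" by blast
    qed
  qed
  ultimately have aI: "a \<in> I" using ab generated_ideal_least unfolding ideal_below_def by blast
  have aB: "a \<in> hered a" by (rule self_in_hered[OF a])
  \<comment> \<open>\<open>a\<close> is close to \<open>a * k * a * l * a\<close>, which is of the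
    form controlled by membership in \<open>I\<close>, with \<open>u = v = a\<close>.\<close>
  have aJ: "a \<in> J"
  proof (rule closed_approx[OF j(2)])
    fix e :: real assume e: "e > 0"
    then obtain k where k: "k \<in> hered a" "norm (a - a * k * a) < e / 2"
      using approx_self_sandwich[OF a, of "e / 2"] by auto
    define N where "N = 1 + norm (a * k)"
    have N: "N > 0" by (simp add: N_def add_pos_nonneg)
    then obtain l where l: "l \<in> hered a" "norm (a - a * l * a) < e / (2 * N)"
      using approx_self_sandwich[OF a, of "e / (2 * N)"] e by auto
    have "a * k * a * l * a \<in> J" using aI aB by (simp add: I_def)
    moreover have "norm (a - a * k * a * l * a) < e"
    proof -
      have "a - a * k * a * l * a = (a - a * k * a) + (a * k) * (a - a * l * a)"
        by (simp add: right_diff_distrib mult.assoc)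
      also have "norm \<dots> \<le> norm (a - a * k * a) + norm (a * k) * norm (a - a * l * a)"
        by (meson add_left_mono norm_mult_ineq norm_triangle_ineq order_trans)
      also have "norm (a * k) * norm (a - a * l * a) \<le> N * norm (a - a * l * a)"
        by (intro mult_right_mono) (simp_all add: N_def)
      also have "N * norm (a - a * l * a) < N * (e / (2 * N))"
        using l(2) N by (intro mult_strict_left_mono) auto
      finally show ?thesis using k(2) N by simp
    qed
    ultimately show "\<exists>y\<in>J. norm (a - y) < e" by blast
  qed
  \<comment> \<open>\<open>a * w * a\<close> is close to \<open>a * (k * (a * w * a))\<close>, where
    \<open>a\<close> is in \<open>J\<close> and the other factor in the hereditary
    subalgebra.\<close>
  have "a * w * a \<in> J" for w
  proof (rule closed_approx[OF j(2)])
    fix e :: real assume e: "e > 0"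
    define N where "N = 1 + norm (w * a)"
    have N: "N > 0" by (simp add: N_def add_pos_nonneg)
    then obtain k where k: "k \<in> hered a" "norm (a - a * k * a) < e / N"
      using approx_self_sandwich[OF a, of "e / N"] e by auto
    have "a * (k * (a * w * a)) \<in> J"
      using j(7)[OF _ aJ] hered_mult[OF k(1) sandwich_in_hered] by blast
    moreover have "norm (a * w * a - a * (k * (a * w * a))) < e"
    proof -
      have "a * w * a - a * (k * (a * w * a)) = (a - a * k * a) * (w * a)"
        by (simp add: left_diff_distrib mult.assoc)
      also have "norm \<dots> \<le> norm (a - a * k * a) * norm (w * a)" by (rule norm_mult_ineq)
      also have "\<dots> \<le> norm (a - a * k * a) * N" by (intro mult_left_mono) (simp_all add: N_def)
      also have "\<dots> < e / N * N" using k(2) N by (intro mult_strict_right_mono) auto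
      finally show ?thesis using N by simp
    qed
    ultimately show "\<exists>y\<in>J. norm (a * w * a - y) < e" by blast
  qed
  then have "range (\<lambda>w. a * w * a) \<subseteq> J" by auto
  then have "hered a \<subseteq> J" unfolding hered_def using j(2) by (rule closure_minimal)
  then show ?thesis using j(1) by auto
qed

text \<open>The invertibility of the cut-down modulo \<open>J\<close> appears as an estimate. The
  unit \<open>e\<close> is nearly \<open>a * v\<close>, hence nearly
  \<open>cut_down a \<epsilon> * v\<close> for small \<open>\<epsilon>\<close>. As \<open>b\<close>
  annihilates the cut-down and \<open>b * e\<close> is congruent to \<open>b\<close>, the distance
  of \<open>b\<close> to \<open>J\<close> is at most 1/2 + 1/4 times itself, so it is 0.\<close>

lemma orthogonal_witnesses_imp_soft:
  assumes a: "a \<in> positives UNIV"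
    and wit: "\<And>\<epsilon>. \<epsilon> > 0 \<Longrightarrow> \<exists>b\<in>positives (hered a). b \<bottom> cut_down a \<epsilon> \<and> a \<lhd> b"
  shows "soft a"
  unfolding soft_positive_iff[OF a] soft_algebra_def
proof (intro allI impI notI)
  fix J assume "closed_ideal (hered a) J \<and> J \<noteq> hered a" and un: "unital (quotient_alg (subalg (hered a)) J)"
  then have J: "closed_ideal (hered a) J" and ne: "J \<noteq> hered a" by auto
  note j = closed_idealD[OF J]
  obtain e where e: "e \<in> hered a" "\<And>x. x \<in> hered a \<Longrightarrow> x * e - x \<in> J"
    using un unital_quotient_iff[OF subalgebra_hered J] by blast
  \<comment> \<open>First \<open>e\<close> is approximated by \<open>a * w * a\<close>, then the
    left \<open>a\<close> by \<open>a * k * a\<close>. The second move puts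
    \<open>v = k * (a * w * a)\<close> into \<open>hered a\<close>, as the distance estimate
    requires of the right factors.\<close>
  obtain v where v: "v \<in> hered a" "norm (e - a * v) < 1/2"
  proof -
    have "e \<in> closure (range (\<lambda>y. a * y * a))" using e(1) by (simp add: hered_def)
    then have "\<exists>s\<in>range (\<lambda>y. a * y * a). dist s e < 1/4"
      unfolding closure_approachable by (meson divide_pos_pos zero_less_one zero_less_numeral)
    then obtain w where w: "norm (e - a * w * a) < 1/4" by (auto simp: dist_norm norm_minus_commute)
    define N where "N = 1 + norm (w * a)"
    have N: "N > 0" by (simp add: N_def add_pos_nonneg)
    then obtain k where k: "k \<in> hered a" "norm (a - a * k * a) < 1 / (4 * N)"
      using approx_self_sandwich[OF a, of "1 / (4 * N)"] by auto
    show ?thesis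
    proof (rule that)
      show "k * (a * w * a) \<in> hered a" by (rule hered_mult[OF k(1) sandwich_in_hered])
      have "e - a * (k * (a * w * a)) = (e - a * w * a) + (a - a * k * a) * (w * a)"
        by (simp add: left_diff_distrib mult.assoc)
      also have "norm \<dots> \<le> norm (e - a * w * a) + norm (a - a * k * a) * norm (w * a)"
        by (meson add_left_mono norm_mult_ineq norm_triangle_ineq order_trans)
      also have "norm (a - a * k * a) * norm (w * a) \<le> norm (a - a * k * a) * N"
        by (intro mult_left_mono) (simp_all add: N_def)
      also have "norm (a - a * k * a) * N < 1 / (4 * N) * N"
        using k(2) N by (intro mult_strict_right_mono) auto
      finally show "norm (e - a * (k * (a * w * a))) < 1/2" using w N by simp
    qed
  qed
  define M where "M = 1 + norm v"
  have M: "M > 0" by (simp add: M_def add_pos_nonneg)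
  \<comment> \<open>Makes \<open>norm (r * v) <= \<epsilon> * M = 1/4\<close>, where
    \<open>r = a - cut_down a \<epsilon>\<close> has norm at most \<open>\<epsilon>\<close>.\<close>
  define \<epsilon> where "\<epsilon> = 1 / (4 * M)"
  have eps: "\<epsilon> > 0" using M by (simp add: \<epsilon>_def)
  obtain b where b: "b \<in> positives (hered a)" "b * cut_down a \<epsilon> = 0" "a \<lhd> b"
    using wit[OF eps] by (auto simp: orthogonal_elts_def)
  have bB: "b \<in> hered a" using b(1) by (simp add: positives_def)
  have bpos: "b \<in> positives UNIV" using b(1) positives_subset_UNIV[OF subalgebra_hered] by blast
  let ?c = "\<lambda>t. complex_of_real (max (t - \<epsilon>) 0)"
  define r where "r = a - cut_down a \<epsilon>"
  have r: "r = cfc a (\<lambda>t. complex_of_real t - ?c t)"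
    using cfc_diff[OF a C0_spec_intros(6) cut_down_in_C0_spec[OF eps]]
    by (simp add: r_def cut_down_eq_cfc[OF a eps] cfc_id[OF a])
  have C: "(\<lambda>t. complex_of_real t - ?c t) \<in> C0_spec a"
    by (intro C0_spec_intros cut_down_in_C0_spec[OF eps])
  have rB: "r \<in> hered a" unfolding r by (rule cfc_in_hered[OF a C])
  have "norm r \<le> \<epsilon>"
    unfolding r
  proof (rule cfc_norm_le[OF a C])
    fix t assume "t \<in> spec0 a"
    then have "\<bar>t - max (t - \<epsilon>) 0\<bar> \<le> \<epsilon>" using spec0_nonneg[OF a, of t] eps by auto
    then show "cmod (complex_of_real t - ?c t) \<le> \<epsilon>" by (metis norm_of_real of_real_diff)
  qed
  have "norm (r * v) \<le> 1/4"
  proof -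
    have "norm (r * v) \<le> norm r * norm v" by (rule norm_mult_ineq)
    also have "\<dots> \<le> \<epsilon> * M" using \<open>norm r \<le> \<epsilon>\<close> eps by (intro mult_mono) (simp_all add: M_def)
    finally show ?thesis using M by (simp add: \<epsilon>_def)
  qed
  have avB: "e - a * v \<in> hered a" "r * v \<in> hered a"
    using hered_diff[OF e(1) hered_mult[OF self_in_hered[OF a] v(1)]] hered_mult[OF rB v(1)] by auto
  have "b * a = b * r" using b(2) by (simp add: r_def right_diff_distrib)
  then have be: "b * e = b * (e - a * v) + b * (r * v)"
    by (simp add: right_diff_distrib flip: mult.assoc)
  have q: "infdist b J \<le> infdist (b * e) J"
    using infdist_ideal_cong[OF J] closed_ideal_minus[OF J e(2)[OF bB]] by (metis minus_diff_eq)
  also have "\<dots> \<le> infdist (b * (e - a * v)) J + infdist (b * (r * v)) J"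
    unfolding be by (rule infdist_ideal_add[OF J])
  also have "\<dots> \<le> infdist b J * norm (e - a * v) + infdist b J * norm (r * v)"
    by (intro add_mono infdist_ideal_mult[OF J] avB)
  also have "\<dots> \<le> infdist b J * (1/2) + infdist b J * (1/4)"
    using v(2) \<open>norm (r * v) \<le> 1/4\<close> by (intro add_mono mult_left_mono infdist_nonneg) auto
  finally have "infdist b J = 0" using infdist_nonneg[of b J] by simp
  then have "b \<in> J" using in_ideal_iff_infdist[OF J] by simp
  then show False using ideal_below_hereditary[OF a J bpos _ b(3)] ne by blast
qed

theorem proposition3p6:
  fixes a :: "'a::cstar_algebra"
  assumes "a \<in> positives UNIV"
  defines "S1 \<equiv> soft a"
    and "S2 \<equiv> (\<forall>I. closed_ideal UNIV I \<longrightarrow>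
      a \<in> I \<or> 0 islimpt spectrum (quotient_alg (subalg UNIV) I) (alg_coset (subalg UNIV) I a))"
    and "S3 \<equiv> (\<forall>\<epsilon>>0. a \<lhd> func_calc (tent \<epsilon>) a)"
    and "S4 \<equiv> (\<forall>\<epsilon>>0. \<exists>b\<in>positives (closure (range (\<lambda>y. a * y * a))).
      b \<bottom> cut_down a \<epsilon> \<and> a \<lhd> b)"
  shows "(S1 \<longleftrightarrow> S2) \<and> (S2 \<longleftrightarrow> S3) \<and> (S3 \<longleftrightarrow> S4)"
proof -
  have "S1 \<Longrightarrow> S2" unfolding S1_def S2_def using soft_imp_limit_point[OF assms(1)] by blast
  moreover have "S2 \<Longrightarrow> S3"
    unfolding S2_def S3_def using limit_point_imp_ideal_below_tent[OF assms(1)] by blast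
  moreover have "S3 \<Longrightarrow> S4"
    unfolding S3_def S4_def hered_def[symmetric] using tent_witness[OF assms(1)] by blast
  moreover have "S4 \<Longrightarrow> S1"
    unfolding S4_def S1_def hered_def[symmetric] using orthogonal_witnesses_imp_soft[OF assms(1)] by blast
  ultimately show ?thesis by blast
qed

end
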